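(* Every element of $\mathrm{Aut}(S)$ of prime order is conjugate in $\mathrm{Aut}(S)$ to a rotation $r_\theta\colon (w:x:y:z)\mapsto(w:x\cos\theta-y\sin\theta:x\sin\theta+y\cos\theta:z)$ for some $\theta\in[0,2\pi)$, or to the reflection $\upsilon\colon(w:x:y:z)\mapsto(w:-x:y:z)$, or to the antipodal involution $\tilde a\colon(w:x:y:z)\mapsto(-w:x:y:z)$.
   Context: $S\subset\mathbb{P}^3_{\mathbb{R}}$ is the real projective surface $w^2=x^2+y^2+z^2$, and $\mathrm{Aut}(S)$ is the group of automorphisms of $S$ as a scheme over $\mathbb{R}$ (biregular at all complex points). *)

theory Defs
  imports
    "HOL-Analysis.Analysis"
    "HOL-Algebra.Bij"
    "HOL-Algebra.Multiplicative_Group"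
begin

section \<open>Real forms in four variables\<close>

text \<open>
  The coordinates (w:x:y:z) on projective 3-space are the components 1, 2, 3, 4 of a vector in
  \<^typ>\<open>complex^4\<close>.  A homogeneous polynomial with real coefficients is represented by the function
  it induces on \<^typ>\<open>complex^4\<close>, which determines its coefficients.
\<close>

definition exponents :: "nat \<Rightarrow> (4 \<Rightarrow> nat) set" where
  "exponents d = {\<alpha>. (\<Sum>i\<in>UNIV. \<alpha> i) = d}"

definition monomial :: "(4 \<Rightarrow> nat) \<Rightarrow> complex^4 \<Rightarrow> complex" where
  "monomial \<alpha> v = (\<Prod>i\<in>UNIV. v $ i ^ \<alpha> i)"

definition real_form :: "nat \<Rightarrow> (complex^4 \<Rightarrow> complex) \<Rightarrow> bool" where
  "real_form d F \<longleftrightarrow>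
     (\<exists>c :: (4 \<Rightarrow> nat) \<Rightarrow> real. \<forall>v. F v = (\<Sum>\<alpha>\<in>exponents d. of_real (c \<alpha>) * monomial \<alpha> v))"

lemma finite_exponents: "finite (exponents d)"
proof -
  have "exponents d \<subseteq> Pi\<^sub>E UNIV (\<lambda>_. {..d})"
  proof
    fix \<alpha> assume a: "\<alpha> \<in> exponents d"
    have "\<alpha> i \<le> (\<Sum>i\<in>UNIV. \<alpha> i)" for i by (rule member_le_sum) auto
    then show "\<alpha> \<in> Pi\<^sub>E UNIV (\<lambda>_. {..d})" using a by (auto simp: exponents_def)
  qed
  then show ?thesis by (rule finite_subset) (rule finite_PiE, auto)
qed

lemma monomial_mult: "monomial \<alpha> v * monomial \<beta> v = monomial (\<lambda>i. \<alpha> i + \<beta> i) v"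
  by (simp add: monomial_def power_add prod.distrib)

lemma real_form_zero: "real_form d (\<lambda>_. 0)"
  unfolding real_form_def by (rule exI[of _ "\<lambda>_. 0"]) simp

lemma real_form_add:
  assumes "real_form d F" "real_form d G" shows "real_form d (\<lambda>v. F v + G v)"
proof -
  obtain a b where "\<And>v. F v = (\<Sum>\<alpha>\<in>exponents d. of_real (a \<alpha>) * monomial \<alpha> v)"
    and "\<And>v. G v = (\<Sum>\<alpha>\<in>exponents d. of_real (b \<alpha>) * monomial \<alpha> v)"
    using assms unfolding real_form_def by blast
  then show ?thesis unfolding real_form_def
    by (intro exI[of _ "\<lambda>\<alpha>. a \<alpha> + b \<alpha>"]) (simp add: algebra_simps sum.distrib)
qed

lemma real_form_scale:
  assumes "real_form d F" shows "real_form d (\<lambda>v. of_real r * F v)"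
proof -
  obtain a where "\<And>v. F v = (\<Sum>\<alpha>\<in>exponents d. of_real (a \<alpha>) * monomial \<alpha> v)"
    using assms unfolding real_form_def by blast
  then show ?thesis unfolding real_form_def
    by (intro exI[of _ "\<lambda>\<alpha>. r * a \<alpha>"]) (simp add: sum_distrib_left algebra_simps)
qed

lemma real_form_sum:
  assumes "\<And>x. x \<in> A \<Longrightarrow> real_form d (F x)" shows "real_form d (\<lambda>v. \<Sum>x\<in>A. F x v)"
  using assms
  by (induction A rule: infinite_finite_induct) (auto intro: real_form_zero real_form_add)

lemma real_form_monomial: "\<alpha> \<in> exponents d \<Longrightarrow> real_form d (monomial \<alpha>)"
  unfolding real_form_def
  by (rule exI[of _ "\<lambda>\<beta>. if \<beta> = \<alpha> then 1 else 0"])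
    (simp add: finite_exponents if_distrib[of of_real] if_distrib[of "\<lambda>x. x * _"] cong: if_cong)

lemma real_form_mult:
  assumes "real_form d F" "real_form e G" shows "real_form (d + e) (\<lambda>v. F v * G v)"
proof -
  obtain a b where F: "\<And>v. F v = (\<Sum>\<alpha>\<in>exponents d. of_real (a \<alpha>) * monomial \<alpha> v)"
    and G: "\<And>v. G v = (\<Sum>\<alpha>\<in>exponents e. of_real (b \<alpha>) * monomial \<alpha> v)"
    using assms unfolding real_form_def by blast
  have eq: "(\<lambda>v. F v * G v) = (\<lambda>v. \<Sum>\<alpha>\<in>exponents d. \<Sum>\<beta>\<in>exponents e.
      of_real (a \<alpha> * b \<beta>) * monomial (\<lambda>i. \<alpha> i + \<beta> i) v)"
    by (simp add: F G sum_product monomial_mult[symmetric] algebra_simps)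
  show ?thesis unfolding eq
    by (intro real_form_sum real_form_scale real_form_monomial)
      (auto simp: exponents_def sum.distrib)
qed

lemma real_form_one: "real_form 0 (\<lambda>_. 1)"
proof -
  have "(\<lambda>_. 1) = monomial (\<lambda>_. 0)" by (simp add: monomial_def fun_eq_iff)
  then show ?thesis using real_form_monomial[of "\<lambda>_. 0" 0] by (simp add: exponents_def)
qed

lemma real_form_power: "real_form d F \<Longrightarrow> real_form (n * d) (\<lambda>v. F v ^ n)"
  by (induction n) (auto simp: real_form_one intro: real_form_mult)

lemma real_form_prod:
  assumes "finite A" "\<And>x. x \<in> A \<Longrightarrow> real_form (d x) (F x)"
  shows "real_form (\<Sum>x\<in>A. d x) (\<lambda>v. \<Prod>x\<in>A. F x v)"
  using assms
  by (induction A rule: finite_induct) (auto simp: real_form_one intro: real_form_mult)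

lemma real_form_subst:
  assumes F: "real_form d F" and G: "\<And>i. real_form e (\<lambda>v. G v $ i)"
  shows "real_form (d * e) (\<lambda>v. F (G v))"
proof -
  obtain a where a: "\<And>v. F v = (\<Sum>\<alpha>\<in>exponents d. of_real (a \<alpha>) * monomial \<alpha> v)"
    using F unfolding real_form_def by blast
  have "real_form (d * e) (\<lambda>v. monomial \<alpha> (G v))" if "\<alpha> \<in> exponents d" for \<alpha>
  proof -
    have "real_form (\<Sum>i\<in>UNIV. \<alpha> i * e) (\<lambda>v. \<Prod>i\<in>UNIV. (G v $ i) ^ \<alpha> i)"
      by (intro real_form_prod real_form_power G) auto
    then show ?thesis
      using that by (simp add: exponents_def monomial_def sum_distrib_right[symmetric])
  qed
  then show ?thesis unfolding a by (intro real_form_sum real_form_scale)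
qed

lemma real_form_homogeneous:
  assumes "real_form d F" shows "F (c *s v) = c ^ d * F v"
proof -
  obtain a where a: "\<And>v. F v = (\<Sum>\<alpha>\<in>exponents d. of_real (a \<alpha>) * monomial \<alpha> v)"
    using assms unfolding real_form_def by blast
  have "monomial \<alpha> (c *s v) = c ^ d * monomial \<alpha> v" if "\<alpha> \<in> exponents d" for \<alpha>
    using that
    by (simp add: monomial_def exponents_def power_mult_distrib prod.distrib power_sum[symmetric])
  then show ?thesis unfolding a by (simp add: sum_distrib_left algebra_simps)
qed

lemma real_form_coord: "real_form 1 (\<lambda>v. v $ i)"
proof -
  have "monomial (\<lambda>j. if j = i then 1 else 0) = (\<lambda>v. v $ i)"
    by (simp add: monomial_def fun_eq_iff if_distrib cong: if_cong)
  then show ?thesis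
    using real_form_monomial[of "\<lambda>j. if j = i then 1 else 0" 1]
    by (simp add: exponents_def)
qed


section \<open>The quadric and its automorphism group\<close>

text \<open>A point of complex projective 3-space is a line through the origin, and
  \<open>ppoint v\<close> is the point with homogeneous coordinates \<open>v\<close> (for nonzero \<open>v\<close>).\<close>

definition ppoint :: "complex^4 \<Rightarrow> (complex^4) set" where
  "ppoint v = range (\<lambda>c. c *s v)"

definition quadric_cone :: "(complex^4) set" where
  "quadric_cone = {v. v \<noteq> 0 \<and> (v $ 1)\<^sup>2 = (v $ 2)\<^sup>2 + (v $ 3)\<^sup>2 + (v $ 4)\<^sup>2}"

text \<open>The set of all complex points of the real surface \<open>w\<^sup>2 = x\<^sup>2 + y\<^sup>2 + z\<^sup>2\<close>.\<close>

definition quadric :: "(complex^4) set set" where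
  "quadric = ppoint ` quadric_cone"

text \<open>
  A morphism over the reals from the quadric, as a scheme over the reals, to itself is determined
  by its action on the complex points, because the quadric is geometrically reduced.  A map on
  the complex points comes from such a morphism iff around each complex point it is given by four
  real forms of the same degree without common zeros there.  The neighbourhood is taken here to be
  the complement of the common zeros of the forms.  This is no restriction: if they represent the
  map only where some real form \<open>G\<close> is nonzero, multiply all four by \<open>G\<close>.
\<close>

definition regular_over_reals :: "((complex^4) set \<Rightarrow> (complex^4) set) \<Rightarrow> bool" where
  "regular_over_reals f \<longleftrightarrow>
     f \<in> quadric \<rightarrow> quadric \<and>
     (\<forall>v\<in>quadric_cone. \<exists>d F. (\<forall>i. real_form d (\<lambda>u. F u $ i)) \<and> F v \<noteq> 0 \<and>
        (\<forall>u\<in>quadric_cone. F u \<noteq> 0 \<longrightarrow> f (ppoint u) = ppoint (F u)))"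

definition Aut_quadric :: "((complex^4) set \<Rightarrow> (complex^4) set) monoid" where
  "Aut_quadric = BijGroup quadric
     \<lparr>carrier := {f \<in> Bij quadric. regular_over_reals f \<and> regular_over_reals (inv_into quadric f)}\<rparr>"

lemma ppoint_eq_iff:
  assumes "u \<noteq> 0" "v \<noteq> 0"
  shows "ppoint u = ppoint v \<longleftrightarrow> (\<exists>c. c \<noteq> 0 \<and> u = c *s v)"
proof
  assume "ppoint u = ppoint v"
  moreover have "u \<in> ppoint u" unfolding ppoint_def by (rule range_eqI[of _ _ 1]) simp
  ultimately obtain c where "u = c *s v" by (auto simp: ppoint_def)
  with assms show "\<exists>c. c \<noteq> 0 \<and> u = c *s v" by (metis vector_smult_lzero)
next
  assume "\<exists>c. c \<noteq> 0 \<and> u = c *s v"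
  then obtain c where c: "c \<noteq> 0" "u = c *s v" by blast
  then have v: "k *s v = (k / c) *s u" for k by (simp add: vector_smult_assoc)
  have u: "k *s u = (k * c) *s v" for k using c by (simp add: vector_smult_assoc)
  show "ppoint u = ppoint v"
  proof (intro equalityI subsetI)
    show "x \<in> ppoint v" if "x \<in> ppoint u" for x
      using that by (auto simp: ppoint_def u simp del: vector_smult_assoc)
    show "x \<in> ppoint u" if "x \<in> ppoint v" for x
    proof -
      obtain k where "x = k *s v" using \<open>x \<in> ppoint v\<close> by (auto simp: ppoint_def)
      then have "x = (k / c) *s u" using v by simp
      then show ?thesis unfolding ppoint_def by (rule range_eqI)
    qed
  qed
qed

lemma ppoint_in_quadric_iff:
  assumes "u \<noteq> 0" shows "ppoint u \<in> quadric \<longleftrightarrow> u \<in> quadric_cone"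
proof
  assume "ppoint u \<in> quadric"
  then obtain v where v: "v \<in> quadric_cone" "ppoint u = ppoint v" by (auto simp: quadric_def)
  then obtain c where "c \<noteq> 0" "u = c *s v"
    using assms ppoint_eq_iff[of u v] by (auto simp: quadric_cone_def)
  then show "u \<in> quadric_cone"
    using assms v by (simp add: quadric_cone_def power_mult_distrib distrib_left[symmetric])
qed (simp add: quadric_def)

lemma regular_compose:
  assumes f: "regular_over_reals f" and g: "regular_over_reals g"
    and h: "\<And>p. p \<in> quadric \<Longrightarrow> h p = f (g p)"
  shows "regular_over_reals h"
  unfolding regular_over_reals_def
proof (intro conjI ballI)
  show "h \<in> quadric \<rightarrow> quadric" using f g h by (auto simp: regular_over_reals_def Pi_iff)
  have G_cone: "G u \<in> quadric_cone"
    if "u \<in> quadric_cone" "G u \<noteq> 0" "g (ppoint u) = ppoint (G u)" for G u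
  proof -
    have "ppoint u \<in> quadric" using that by (simp add: quadric_def)
    then have "g (ppoint u) \<in> quadric" using g by (auto simp: regular_over_reals_def)
    then show ?thesis using that ppoint_in_quadric_iff[of "G u"] by simp
  qed
  fix v assume v: "v \<in> quadric_cone"
  obtain e G where G: "\<And>i. real_form e (\<lambda>u. G u $ i)" "G v \<noteq> 0"
    "\<And>u. u \<in> quadric_cone \<Longrightarrow> G u \<noteq> 0 \<Longrightarrow> g (ppoint u) = ppoint (G u)"
    using g v unfolding regular_over_reals_def by blast
  have Gv: "G v \<in> quadric_cone" using G_cone G v by blast
  obtain d F where F: "\<And>i. real_form d (\<lambda>u. F u $ i)" "F (G v) \<noteq> 0"
    "\<And>u. u \<in> quadric_cone \<Longrightarrow> F u \<noteq> 0 \<Longrightarrow> f (ppoint u) = ppoint (F u)"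
    using f Gv unfolding regular_over_reals_def by blast
  text \<open>Where \<open>G\<close> vanishes, \<open>F \<circ> G\<close> need not; multiplying by a coordinate of \<open>G\<close>
    that is nonzero at \<open>v\<close> excludes these points.\<close>
  obtain j where j: "G v $ j \<noteq> 0" using G(2) by (auto simp: vec_eq_iff)
  define H where "H u = (G u $ j) *s F (G u)" for u
  show "\<exists>d F. (\<forall>i. real_form d (\<lambda>u. F u $ i)) \<and> F v \<noteq> 0 \<and>
        (\<forall>u\<in>quadric_cone. F u \<noteq> 0 \<longrightarrow> h (ppoint u) = ppoint (F u))"
  proof (intro exI[of _ "e + d * e"] exI[of _ H] conjI allI ballI impI)
    show "real_form (e + d * e) (\<lambda>u. H u $ i)" for i
      unfolding H_def vector_smult_component
      by (intro real_form_mult G(1) real_form_subst[of d "\<lambda>u. F u $ i"] F(1))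
    show "H v \<noteq> 0" using j F(2) by (simp add: H_def)
    fix u assume u: "u \<in> quadric_cone" and Hu: "H u \<noteq> 0"
    from Hu have ne: "G u $ j \<noteq> 0" "F (G u) \<noteq> 0" by (auto simp: H_def)
    then have Gu: "G u \<noteq> 0" by auto
    have "h (ppoint u) = f (ppoint (G u))"
      using u G(3)[OF u Gu] by (simp add: h quadric_def)
    also have "\<dots> = ppoint (F (G u))"
      using F(3)[of "G u"] G_cone[of u G] u Gu G(3) ne(2) by blast
    also have "\<dots> = ppoint (H u)"
      using ne Hu ppoint_eq_iff[of "H u" "F (G u)"] by (auto simp: H_def)
    finally show "h (ppoint u) = ppoint (H u)" .
  qed
qed

lemma regular_cong:
  assumes "regular_over_reals f" "\<And>p. p \<in> quadric \<Longrightarrow> h p = f p" shows "regular_over_reals h"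
proof -
  have "h (ppoint u) = f (ppoint u)" if "u \<in> quadric_cone" for u
    using that by (intro assms(2)) (simp add: quadric_def)
  moreover have "h \<in> quadric \<rightarrow> quadric"
    using assms by (auto simp: regular_over_reals_def Pi_iff)
  ultimately show ?thesis
    using assms(1) unfolding regular_over_reals_def by simp
qed

lemma regular_id: "regular_over_reals (\<lambda>p. p)"
  unfolding regular_over_reals_def
  by (auto simp: quadric_cone_def intro!: exI[of _ 1] exI[of _ "\<lambda>v. v"] real_form_coord[unfolded One_nat_def])

lemma subgroup_Aut_quadric: "subgroup (carrier Aut_quadric) (BijGroup quadric)"
proof (rule subgroup.intro)
  show "carrier Aut_quadric \<subseteq> carrier (BijGroup quadric)" by (auto simp: Aut_quadric_def BijGroup_def)
  show "\<one>\<^bsub>BijGroup quadric\<^esub> \<in> carrier Aut_quadric"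
  proof -
    have "inv_into quadric (\<lambda>p\<in>quadric. p) p = p" if "p \<in> quadric" for p
      using that inv_into_f_f[of "\<lambda>p\<in>quadric. p" quadric p] by (simp add: inj_on_def)
    then show ?thesis
      using regular_cong[OF regular_id, of "\<lambda>p\<in>quadric. p"] regular_cong[OF regular_id]
      by (simp add: Aut_quadric_def BijGroup_def id_Bij)
  qed
next
  fix f g assume fg: "f \<in> carrier Aut_quadric" "g \<in> carrier Aut_quadric"
  then have B: "f \<in> Bij quadric" "g \<in> Bij quadric"
    and R: "regular_over_reals f" "regular_over_reals g"
      "regular_over_reals (inv_into quadric f)" "regular_over_reals (inv_into quadric g)"
    by (auto simp: Aut_quadric_def)
  have c: "f \<otimes>\<^bsub>BijGroup quadric\<^esub> g = compose quadric f g" using B by (simp add: BijGroup_def)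
  have "inv_into quadric (compose quadric f g) p = inv_into quadric g (inv_into quadric f p)" if "p \<in> quadric" for p
  proof -
    let ?q = "inv_into quadric g (inv_into quadric f p)"
    have q: "inv_into quadric f p \<in> quadric" "?q \<in> quadric" using B that by (auto intro: Bij_inv_into_mem)
    have "compose quadric f g ?q = p"
      using B that q by (auto simp: compose_def Bij_def bij_betw_def f_inv_into_f)
    moreover have "inj_on (compose quadric f g) quadric"
      using compose_Bij[OF B] by (simp add: Bij_def bij_betw_def)
    ultimately show ?thesis using q(2) by (metis inv_into_f_f)
  qed
  then have "regular_over_reals (inv_into quadric (compose quadric f g))"
    by (rule regular_compose[OF R(4,3)])
  moreover have "regular_over_reals (compose quadric f g)"
    by (rule regular_compose[OF R(1,2)]) (simp add: compose_def)
  ultimately show "f \<otimes>\<^bsub>BijGroup quadric\<^esub> g \<in> carrier Aut_quadric"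
    unfolding c using compose_Bij[OF B] by (simp add: Aut_quadric_def)
next
  fix f assume "f \<in> carrier Aut_quadric"
  then have B: "f \<in> Bij quadric"
    and R: "regular_over_reals f" "regular_over_reals (inv_into quadric f)"
    by (auto simp: Aut_quadric_def)
  let ?g = "\<lambda>p\<in>quadric. inv_into quadric f p"
  have g: "?g \<in> Bij quadric" by (rule restrict_inv_into_Bij[OF B])
  have "inv_into quadric ?g p = f p" if "p \<in> quadric" for p
  proof -
    have "f p \<in> quadric" "?g (f p) = p" using B that by (auto simp: Bij_def bij_betw_def)
    moreover have "inj_on ?g quadric" using g by (simp add: Bij_def bij_betw_def)
    ultimately show ?thesis by (metis inv_into_f_f)
  qed
  then have "regular_over_reals (inv_into quadric ?g)" by (rule regular_cong[OF R(1)])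
  moreover have "regular_over_reals ?g" by (rule regular_cong[OF R(2)]) simp
  ultimately show "inv\<^bsub>BijGroup quadric\<^esub> f \<in> carrier Aut_quadric"
    using g by (simp add: Aut_quadric_def inv_BijGroup[OF B])
qed

lemma group_Aut_quadric: "group Aut_quadric"
proof -
  have "Aut_quadric = BijGroup quadric\<lparr>carrier := carrier Aut_quadric\<rparr>" by (simp add: Aut_quadric_def)
  then show ?thesis
    using subgroup.subgroup_is_group[OF subgroup_Aut_quadric group_BijGroup] by simp
qed

definition conjugate_in :: "('a, 'b) monoid_scheme \<Rightarrow> 'a \<Rightarrow> 'a \<Rightarrow> bool" where
  "conjugate_in G a b \<longleftrightarrow> (\<exists>h\<in>carrier G. h \<otimes>\<^bsub>G\<^esub> a \<otimes>\<^bsub>G\<^esub> inv\<^bsub>G\<^esub> h = b)"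


section \<open>Rotations, the reflection and the antipodal involution\<close>

text \<open>The effect of a linear map on a point of projective space is to take the image of the line.\<close>

definition induced :: "(complex^4 \<Rightarrow> complex^4) \<Rightarrow> (complex^4) set \<Rightarrow> (complex^4) set" where
  "induced L = (\<lambda>p\<in>quadric. L ` p)"

definition rotation :: "real \<Rightarrow> (complex^4) set \<Rightarrow> (complex^4) set" where
  "rotation \<theta> = induced (\<lambda>v. vector
     [v $ 1,
      v $ 2 * of_real (cos \<theta>) - v $ 3 * of_real (sin \<theta>),
      v $ 2 * of_real (sin \<theta>) + v $ 3 * of_real (cos \<theta>),
      v $ 4])"

definition reflection :: "(complex^4) set \<Rightarrow> (complex^4) set" where
  "reflection = induced (\<lambda>v. vector [v $ 1, - v $ 2, v $ 3, v $ 4])"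

definition antipodal :: "(complex^4) set \<Rightarrow> (complex^4) set" where
  "antipodal = induced (\<lambda>v. vector [- v $ 1, v $ 2, v $ 3, v $ 4])"

lemma vector_4_nth:
  "(vector [a, b, c, d] :: 'a::zero^4) $ 1 = a"
  "(vector [a, b, c, d] :: 'a::zero^4) $ 2 = b"
  "(vector [a, b, c, d] :: 'a::zero^4) $ 3 = c"
  "(vector [a, b, c, d] :: 'a::zero^4) $ 4 = d"
  by (simp_all add: vector_def)

lemma induced_ppoint:
  assumes L: "\<And>i. real_form 1 (\<lambda>u. L u $ i)" and v: "v \<in> quadric_cone"
  shows "induced L (ppoint v) = ppoint (L v)"
proof -
  have "L (c *s v) = c *s L v" for c
    using real_form_homogeneous[OF L] by (simp add: vec_eq_iff)
  then have "L ` ppoint v = ppoint (L v)" by (simp add: ppoint_def image_image)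
  then show ?thesis using v by (simp add: induced_def quadric_def)
qed

lemma regular_induced:
  assumes L: "\<And>i. real_form 1 (\<lambda>u. L u $ i)"
    and cone: "\<And>v. v \<in> quadric_cone \<Longrightarrow> L v \<in> quadric_cone"
  shows "regular_over_reals (induced L)"
  unfolding regular_over_reals_def
proof (intro conjI ballI)
  show "induced L \<in> quadric \<rightarrow> quadric"
    using induced_ppoint[OF L] cone by (auto simp: quadric_def)
  fix v assume v: "v \<in> quadric_cone"
  show "\<exists>d F. (\<forall>i. real_form d (\<lambda>u. F u $ i)) \<and> F v \<noteq> 0 \<and>
        (\<forall>u\<in>quadric_cone. F u \<noteq> 0 \<longrightarrow> induced L (ppoint u) = ppoint (F u))"
    using L induced_ppoint[OF L] cone[OF v]
    by (intro exI[of _ 1] exI[of _ L]) (auto simp: quadric_cone_def)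
qed

lemma induced_in_Aut_quadric:
  assumes L: "\<And>i. real_form 1 (\<lambda>u. L u $ i)"
    and K: "\<And>i. real_form 1 (\<lambda>u. K u $ i)"
    and coneL: "\<And>v. v \<in> quadric_cone \<Longrightarrow> L v \<in> quadric_cone"
    and coneK: "\<And>v. v \<in> quadric_cone \<Longrightarrow> K v \<in> quadric_cone"
    and LK: "\<And>v. L (K v) = v" and KL: "\<And>v. K (L v) = v"
  shows "induced L \<in> carrier Aut_quadric"
proof -
  have into: "induced L p \<in> quadric" "induced K p \<in> quadric" if "p \<in> quadric" for p
    using that induced_ppoint[OF L] induced_ppoint[OF K] coneL coneK by (auto simp: quadric_def)
  have inverse: "induced L (induced K p) = p" "induced K (induced L p) = p" if "p \<in> quadric" for p
    using that induced_ppoint[OF L] induced_ppoint[OF K] coneL coneK by (auto simp: quadric_def LK KL)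
  have b: "bij_betw (induced L) quadric quadric"
    by (rule bij_betw_byWitness[where f' = "induced K"]) (auto simp: into inverse)
  have "inv_into quadric (induced L) p = induced K p" if "p \<in> quadric" for p
    using b that into inverse by (metis bij_betw_def inv_into_f_f)
  then have "regular_over_reals (inv_into quadric (induced L))"
    using regular_cong[OF regular_induced[OF K coneK]] by blast
  then show ?thesis
    using b regular_induced[OF L coneL] by (simp add: Aut_quadric_def Bij_def induced_def)
qed

lemma real_form_diff:
  assumes "real_form d F" "real_form d G" shows "real_form d (\<lambda>v. F v - G v)"
  using real_form_add[OF assms(1) real_form_scale[OF assms(2), of "-1"]] by simp

lemma real_form_minus_coord: "real_form 1 (\<lambda>v. - v $ i)"
  using real_form_scale[OF real_form_coord[of i], of "-1"] by simp

lemma real_form_coord_times: "real_form 1 (\<lambda>v. v $ i * of_real r)"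
  using real_form_scale[OF real_form_coord[of i], of r] by (simp add: mult.commute)

lemmas linear_form_intros =
  real_form_add real_form_diff real_form_coord real_form_minus_coord real_form_coord_times

lemma reflection_in_Aut_quadric: "reflection \<in> carrier Aut_quadric"
  unfolding reflection_def
proof (rule induced_in_Aut_quadric)
  let ?L = "\<lambda>v :: complex^4. vector [v $ 1, - v $ 2, v $ 3, v $ 4] :: complex^4"
  have "\<forall>i. real_form 1 (\<lambda>u. ?L u $ i)"
    unfolding forall_4 vector_4_nth by (intro conjI linear_form_intros)
  then show "real_form 1 (\<lambda>u. ?L u $ i)" "real_form 1 (\<lambda>u. ?L u $ i)" for i by auto
qed (auto simp: vec_eq_iff forall_4 vector_4_nth quadric_cone_def)

lemma antipodal_in_Aut_quadric: "antipodal \<in> carrier Aut_quadric"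
  unfolding antipodal_def
proof (rule induced_in_Aut_quadric)
  let ?L = "\<lambda>v :: complex^4. vector [- v $ 1, v $ 2, v $ 3, v $ 4] :: complex^4"
  have "\<forall>i. real_form 1 (\<lambda>u. ?L u $ i)"
    unfolding forall_4 vector_4_nth by (intro conjI linear_form_intros)
  then show "real_form 1 (\<lambda>u. ?L u $ i)" "real_form 1 (\<lambda>u. ?L u $ i)" for i by auto
qed (auto simp: vec_eq_iff forall_4 vector_4_nth quadric_cone_def)

lemma rotation_in_Aut_quadric: "rotation \<theta> \<in> carrier Aut_quadric"
proof -
  define R :: "real \<Rightarrow> complex^4 \<Rightarrow> complex^4" where "R t v = vector [v $ 1, v $ 2 * of_real (cos t) - v $ 3 * of_real (sin t),
    v $ 2 * of_real (sin t) + v $ 3 * of_real (cos t), v $ 4]" for t v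
  have forms: "real_form 1 (\<lambda>u. R t u $ i)" for t i
  proof -
    have "\<forall>i. real_form 1 (\<lambda>u. R t u $ i)"
      unfolding forall_4 vector_4_nth R_def by (intro conjI linear_form_intros)
    then show ?thesis by auto
  qed
  have inverse: "R t (R (- t) v) = v" for t v
  proof -
    define c s where "c = complex_of_real (cos t)" and "s = complex_of_real (sin t)"
    have cs: "c * c + s * s = 1"
      unfolding c_def s_def of_real_mult[symmetric] of_real_add[symmetric]
      by (simp add: power2_eq_square[symmetric])
    have "(v $ 2 * c + v $ 3 * s) * c - (v $ 3 * c - v $ 2 * s) * s = v $ 2 * (c * c + s * s)"
      "(v $ 2 * c + v $ 3 * s) * s + (v $ 3 * c - v $ 2 * s) * c = v $ 3 * (c * c + s * s)"
      by (simp_all add: algebra_simps)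
    with cs have "(v $ 2 * c + v $ 3 * s) * c - (v $ 3 * c - v $ 2 * s) * s = v $ 2"
      "(v $ 2 * c + v $ 3 * s) * s + (v $ 3 * c - v $ 2 * s) * c = v $ 3"
      by simp_all
    then show ?thesis
      unfolding vec_eq_iff forall_4 R_def vector_4_nth cos_minus sin_minus of_real_minus
        c_def[symmetric] s_def[symmetric]
      by auto
  qed
  have cone: "R t v \<in> quadric_cone" if v: "v \<in> quadric_cone" for t v
  proof -
    define c s where "c = complex_of_real (cos t)" and "s = complex_of_real (sin t)"
    have cs: "c * c + s * s = 1"
      unfolding c_def s_def of_real_mult[symmetric] of_real_add[symmetric]
      by (simp add: power2_eq_square[symmetric])
    have "R t v \<noteq> 0"
    proof
      assume 0: "R t v = 0"
      have "R (- t) (R t v) = v" using inverse[of "- t" v] by simp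
      then have "v = R (- t) 0" using 0 by simp
      also have "\<dots> = 0" by (simp add: vec_eq_iff forall_4 R_def vector_4_nth)
      finally show False using v by (simp add: quadric_cone_def)
    qed
    moreover have "(v $ 2 * c - v $ 3 * s)\<^sup>2 + (v $ 2 * s + v $ 3 * c)\<^sup>2
        = ((v $ 2)\<^sup>2 + (v $ 3)\<^sup>2) * (c * c + s * s)"
      by (simp add: power2_eq_square algebra_simps)
    ultimately show ?thesis
      using v cs
      by (simp add: quadric_cone_def R_def vector_4_nth c_def[symmetric] s_def[symmetric])
  qed
  have "induced (R \<theta>) \<in> carrier Aut_quadric"
    by (rule induced_in_Aut_quadric[of _ "R (- \<theta>)"])
      (use forms cone inverse[of \<theta>] inverse[of "- \<theta>"] in auto)
  then show ?thesis by (simp add: rotation_def R_def[abs_def])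
qed

end

theory Submission
  imports Defs
    "HOL-Computational_Algebra.Field_as_Ring"
    "HOL-Computational_Algebra.Polynomial_Factorial"
    "HOL-Computational_Algebra.Fundamental_Theorem_Algebra"
begin

text \<open>
  Read a vector \<open>v = (w, x, y, z)\<close> as the matrix with rows \<open>(w + z, x + \<i> y)\<close> and
  \<open>(x - \<i> y, w - z)\<close>.  Its determinant is \<open>w\<^sup>2 - x\<^sup>2 - y\<^sup>2 - z\<^sup>2\<close>, so the complex points of the
  quadric are the matrices \<open>s t\<^sup>T\<close> of rank one up to scalars, that is, pairs \<open>(s, t)\<close> of points of
  the projective line.  Conjugating \<open>v\<close> is taking the Hermitian transpose, so the real structure
  is \<open>(s, t) \<mapsto> (cnj t, cnj s)\<close>.

  The main step is that an automorphism \<open>f\<close> is \<open>(s, t) \<mapsto> (A s, (cnj A) t)\<close> or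
  \<open>(s, t) \<mapsto> (B t, (cnj B) s)\<close> for an invertible matrix (\<open>Aut_quadric_cases\<close>).  The first parameter
  of \<open>f\<close> is locally given by pairs of bihomogeneous forms in \<open>s\<close> and \<open>t\<close>.  By unique
  factorization in the polynomial ring in two variables, one such pair without common zeros gives it
  everywhere (\<open>global_representation\<close>); let \<open>(a, b)\<close> be its bidegree.  Since \<open>f\<close> is
  defined over the reals, the second parameter has bidegree \<open>(b, a)\<close>.  If \<open>(a', b')\<close> belongs to
  the inverse of \<open>f\<close> in the same way, the composite, which is the identity, has a first parameter of
  bidegree \<open>(a a' + b b', a b' + b a')\<close>.  A pair of forms without common zeros that represents
  \<open>(s, t) \<mapsto> s\<close> has bidegree \<open>(1, 0)\<close> (\<open>biform_pair_proportional_to_fst\<close>, by the fundamental theorem of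
  algebra).  For natural numbers this forces \<open>(a, b)\<close> to be \<open>(1, 0)\<close> or \<open>(0, 1)\<close>, and
  such forms are linear in one parameter.  Conversely, every invertible \<open>A\<close> acts on the quadric by
  \<open>M \<mapsto> A M A\<^sup>*\<close>, and these automorphisms suffice for the conjugations below.

  If \<open>f\<close> is of the first kind and of prime order \<open>n\<close>, then \<open>A\<^sup>n\<close> is scalar but \<open>A\<close> is not, so \<open>A\<close> is
  diagonalizable and the ratio of its eigenvalues is a root of unity \<open>cis \<theta>\<close>
  (\<open>scalar_or_diagonalizable\<close>).  After diagonalization \<open>f\<close> is the rotation by \<open>\<theta>\<close>.

  If \<open>f\<close> is of the second kind, its odd powers are again of the second kind, so a prime order must
  be two.  Then \<open>B (cnj B)\<close> is a scalar, it is real, and it may be scaled to \<open>e = \<plusminus>1\<close>.  Conjugating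
  \<open>f\<close> by the action of \<open>A\<close> replaces \<open>B\<close> by \<open>A B (cnj A)\<^sup>-\<^sup>1\<close>, and an averaging argument shows that any
  two matrices with the same sign \<open>e\<close> are related in this way (\<open>swapped_conjugator\<close>).  The
  reflection has sign \<open>1\<close> and the antipodal involution has sign \<open>-1\<close>.
\<close>

section \<open>Bihomogeneous forms in two pairs of variables\<close>

text \<open>
  Homogeneous coordinates on the projective line are pairs \<open>s\<close> with affine coordinate
  \<open>s\<^sub>2 / s\<^sub>1\<close>, so the point at infinity is where the first component vanishes.  The formal
  degree \<open>n\<close> is a separate argument, because \<open>p\<close> may have smaller degree: the homogenization
  then vanishes at infinity.
\<close>

definition homogenize :: "nat \<Rightarrow> complex poly \<Rightarrow> complex^2 \<Rightarrow> complex" where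
  "homogenize n p s = (\<Sum>i\<le>n. Polynomial.coeff p i * s $ 2 ^ i * s $ 1 ^ (n - i))"

lemma homogenize_0 [simp]: "homogenize n 0 s = 0"
  by (simp add: homogenize_def)

lemma homogenize_add: "homogenize n (p + q) s = homogenize n p s + homogenize n q s"
  by (simp add: homogenize_def algebra_simps sum.distrib)

lemma homogenize_sum: "homogenize n (\<Sum>x\<in>A. f x) s = (\<Sum>x\<in>A. homogenize n (f x) s)"
  by (induction A rule: infinite_finite_induct) (auto simp: homogenize_add)

lemma homogenize_at_infinity: "s $ 1 = 0 \<Longrightarrow> homogenize n p s = Polynomial.coeff p n * s $ 2 ^ n"
proof -
  assume s: "s $ 1 = 0"
  have "homogenize n p s = (\<Sum>i\<in>{n}. Polynomial.coeff p i * s $ 2 ^ i * s $ 1 ^ (n - i))"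
    unfolding homogenize_def by (rule sum.mono_neutral_right) (auto simp: s)
  then show ?thesis by simp
qed

lemma poly_eq_sum_atMost:
  fixes p :: "'a::comm_semiring_1 poly"
  assumes "degree p \<le> n" shows "poly p x = (\<Sum>i\<le>n. Polynomial.coeff p i * x ^ i)"
proof -
  have "(\<Sum>i\<le>degree p. Polynomial.coeff p i * x ^ i) = (\<Sum>i\<le>n. Polynomial.coeff p i * x ^ i)"
    by (rule sum.mono_neutral_left) (use assms in \<open>auto simp: coeff_eq_0\<close>)
  then show ?thesis by (simp add: poly_altdef)
qed

lemma homogenize_affine:
  assumes "degree p \<le> n" "s $ 1 \<noteq> 0"
  shows "homogenize n p s = s $ 1 ^ n * poly p (s $ 2 / s $ 1)"
  unfolding homogenize_def poly_eq_sum_atMost[OF assms(1)] sum_distrib_left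
proof (rule sum.cong)
  fix i assume "i \<in> {..n}"
  then have "s $ 1 ^ n = s $ 1 ^ (n - i) * s $ 1 ^ i" by (simp flip: power_add)
  then show "Polynomial.coeff p i * s $ 2 ^ i * s $ 1 ^ (n - i)
      = s $ 1 ^ n * (Polynomial.coeff p i * (s $ 2 / s $ 1) ^ i)"
    using assms(2) by (simp add: power_divide)
qed simp

lemma coeff_mult_top:
  fixes p q :: "'a::comm_semiring_0 poly"
  assumes "degree p \<le> m" "degree q \<le> n"
  shows "Polynomial.coeff (p * q) (m + n) = Polynomial.coeff p m * Polynomial.coeff q n"
proof -
  have "Polynomial.coeff (p * q) (m + n)
      = (\<Sum>i\<in>{m}. Polynomial.coeff p i * Polynomial.coeff q (m + n - i))"
    unfolding coeff_mult
  proof (rule sum.mono_neutral_right)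
    show "\<forall>i\<in>{..m + n} - {m}. Polynomial.coeff p i * Polynomial.coeff q (m + n - i) = 0"
    proof
      fix i assume "i \<in> {..m + n} - {m}"
      then have "i > m \<or> m + n - i > n" by auto
      then show "Polynomial.coeff p i * Polynomial.coeff q (m + n - i) = 0"
        using assms by (auto simp: coeff_eq_0)
    qed
  qed auto
  then show ?thesis by simp
qed

text \<open>
  Away from infinity this is multiplicativity of evaluation; at infinity it says that the
  coefficients at the formal degrees multiply.
\<close>

lemma homogenize_mult:
  assumes "degree p \<le> m" "degree q \<le> n"
  shows "homogenize (m + n) (p * q) s = homogenize m p s * homogenize n q s"
proof (cases "s $ 1 = 0")
  case True
  then show ?thesis
    by (simp add: homogenize_at_infinity coeff_mult_top[OF assms] power_add)
next
  case False
  have "degree (p * q) \<le> m + n" using degree_mult_le[of p q] assms by linarith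
  then show ?thesis using False assms by (simp add: homogenize_affine power_add)
qed

text \<open>
  A polynomial in two variables is a polynomial in \<open>x\<close> whose coefficients are polynomials in
  \<open>y\<close>.  Unique factorization and greatest common divisors then come from iterating
  Gauss's lemma.
\<close>

definition bdeg_le :: "nat \<Rightarrow> nat \<Rightarrow> complex poly poly \<Rightarrow> bool" where
  "bdeg_le a b p \<longleftrightarrow> degree p \<le> a \<and> (\<forall>i. degree (Polynomial.coeff p i) \<le> b)"

text \<open>
  The homogenization in \<open>y\<close>, evaluated at \<open>t\<close>, leaves a polynomial in \<open>x\<close> alone.  Doing the
  two variables one after the other reduces multiplicativity in two variables to that in one.
\<close>

definition inner_homogenize :: "nat \<Rightarrow> complex poly poly \<Rightarrow> complex^2 \<Rightarrow> complex poly" where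
  "inner_homogenize b p t = map_poly (\<lambda>c. homogenize b c t) p"

definition bihomogenize ::
    "nat \<Rightarrow> nat \<Rightarrow> complex poly poly \<Rightarrow> complex^2 \<Rightarrow> complex^2 \<Rightarrow> complex" where
  "bihomogenize a b p s t = homogenize a (inner_homogenize b p t) s"

lemma coeff_inner_homogenize [simp]:
  "Polynomial.coeff (inner_homogenize b p t) i = homogenize b (Polynomial.coeff p i) t"
  by (simp add: inner_homogenize_def coeff_map_poly)

lemma degree_inner_homogenize: "bdeg_le a b p \<Longrightarrow> degree (inner_homogenize b p t) \<le> a"
  by (intro degree_le) (auto simp: bdeg_le_def coeff_eq_0)

lemma bdeg_le_add: "bdeg_le a b p \<Longrightarrow> bdeg_le a b q \<Longrightarrow> bdeg_le a b (p + q)"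
  by (auto simp: bdeg_le_def intro: degree_add_le)

lemma bdeg_le_mult: "bdeg_le a b p \<Longrightarrow> bdeg_le a' b' q \<Longrightarrow> bdeg_le (a + a') (b + b') (p * q)"
  unfolding bdeg_le_def coeff_mult
  by (auto intro!: degree_sum_le order_trans[OF degree_mult_le] add_mono)

lemma inner_homogenize_add:
  "inner_homogenize b (p + q) t = inner_homogenize b p t + inner_homogenize b q t"
  by (rule poly_eqI) (simp add: homogenize_add)

lemma inner_homogenize_mult:
  assumes "\<And>i. degree (Polynomial.coeff p i) \<le> b" "\<And>i. degree (Polynomial.coeff q i) \<le> b'"
  shows "inner_homogenize (b + b') (p * q) t = inner_homogenize b p t * inner_homogenize b' q t"
  by (rule poly_eqI) (simp add: coeff_mult homogenize_sum homogenize_mult[OF assms])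

lemma bihomogenize_add:
  "bihomogenize a b (p + q) s t = bihomogenize a b p s t + bihomogenize a b q s t"
  by (simp add: bihomogenize_def inner_homogenize_add homogenize_add)

lemma bihomogenize_mult:
  assumes "bdeg_le a b p" "bdeg_le a' b' q"
  shows "bihomogenize (a + a') (b + b') (p * q) s t = bihomogenize a b p s t * bihomogenize a' b' q s t"
  using assms
  by (simp add: bihomogenize_def inner_homogenize_mult bdeg_le_def
      homogenize_mult[OF degree_inner_homogenize[OF assms(1)] degree_inner_homogenize[OF assms(2)]])

text \<open>
  The forms of bidegree \<open>(a, b)\<close> on pairs of vectors.  Generating them by sums and products
  makes closure under substitution a rule induction; that they are the homogenizations of
  polynomials of bounded bidegree is then a theorem.
\<close>

inductive biform :: "nat \<Rightarrow> nat \<Rightarrow> (complex^2 \<Rightarrow> complex^2 \<Rightarrow> complex) \<Rightarrow> bool" where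
  biform_zero: "biform a b (\<lambda>s t. 0)"
| biform_const: "biform 0 0 (\<lambda>s t. c)"
| biform_fst: "biform 1 0 (\<lambda>s t. s $ i)"
| biform_snd: "biform 0 1 (\<lambda>s t. t $ i)"
| biform_add: "biform a b \<phi> \<Longrightarrow> biform a b \<psi> \<Longrightarrow> biform a b (\<lambda>s t. \<phi> s t + \<psi> s t)"
| biform_mult: "biform a b \<phi> \<Longrightarrow> biform c d \<psi> \<Longrightarrow> biform (a + c) (b + d) (\<lambda>s t. \<phi> s t * \<psi> s t)"

lemma biform_imp_bihomogenize:
  "biform a b \<phi> \<Longrightarrow> \<exists>p. bdeg_le a b p \<and> (\<forall>s t. \<phi> s t = bihomogenize a b p s t)"
proof (induction rule: biform.induct)
  case (biform_zero a b)
  show ?case by (rule exI[of _ 0]) (simp add: bdeg_le_def bihomogenize_def inner_homogenize_def)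
next
  case (biform_const c)
  show ?case
    by (rule exI[of _ "[:[:c:]:]"]) (simp add: bdeg_le_def bihomogenize_def homogenize_def coeff_pCons split: nat.split)
next
  case (biform_fst i)
  consider "i = 1" | "i = 2" using exhaust_2 by blast
  then show ?case
  proof cases
    case 1 then show ?thesis
      by (intro exI[of _ "[:1:]"]) (simp add: bdeg_le_def bihomogenize_def homogenize_def coeff_pCons split: nat.split)
  next
    case 2 then show ?thesis
      by (intro exI[of _ "[:0, 1:]"]) (simp add: bdeg_le_def bihomogenize_def homogenize_def coeff_pCons split: nat.split)
  qed
next
  case (biform_snd i)
  consider "i = 1" | "i = 2" using exhaust_2 by blast
  then show ?case
  proof cases
    case 1 then show ?thesis
      by (intro exI[of _ "[:[:1:]:]"]) (simp add: bdeg_le_def bihomogenize_def homogenize_def coeff_pCons split: nat.split)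
  next
    case 2 then show ?thesis
      by (intro exI[of _ "[:[:0, 1:]:]"]) (simp add: bdeg_le_def bihomogenize_def homogenize_def coeff_pCons split: nat.split)
  qed
next
  case (biform_add a b \<phi> \<psi>)
  then show ?case by (metis bdeg_le_add bihomogenize_add)
next
  case (biform_mult a b \<phi> c d \<psi>)
  then show ?case by (metis bdeg_le_mult bihomogenize_mult)
qed

lemma biform_scale: "biform a b \<phi> \<Longrightarrow> biform a b (\<lambda>s t. c * \<phi> s t)"
  using biform_mult[OF biform_const[of c]] by simp

lemma biform_sum: "(\<And>x. x \<in> A \<Longrightarrow> biform a b (\<phi> x)) \<Longrightarrow> biform a b (\<lambda>s t. \<Sum>x\<in>A. \<phi> x s t)"
  by (induction A rule: infinite_finite_induct) (auto intro: biform_zero biform_add)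

lemma biform_power: "biform a b \<phi> \<Longrightarrow> biform (n * a) (n * b) (\<lambda>s t. \<phi> s t ^ n)"
  by (induction n) (auto intro: biform_const biform_mult)

lemma biform_prod:
  assumes "finite A" "\<And>x. x \<in> A \<Longrightarrow> biform (a x) (b x) (\<phi> x)"
  shows "biform (\<Sum>x\<in>A. a x) (\<Sum>x\<in>A. b x) (\<lambda>s t. \<Prod>x\<in>A. \<phi> x s t)"
  using assms by (induction A rule: finite_induct) (auto intro: biform_const biform_mult)

lemma biform_bihomogenize: "biform a b (bihomogenize a b p)"
proof -
  have s: "biform n 0 (\<lambda>s t. s $ i ^ n)" for i n
    using biform_power[OF biform_fst, of n i] by simp
  have t: "biform 0 n (\<lambda>s t. t $ i ^ n)" for i n
    using biform_power[OF biform_snd, of n i] by simp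
  have monom: "biform (i + (a - i)) (j + (b - j))
      (\<lambda>s t. c * (s $ 2 ^ i * s $ 1 ^ (a - i) * (t $ 2 ^ j * t $ 1 ^ (b - j))))" for c i j
    using biform_scale[OF biform_mult[OF biform_mult[OF s[of i 2] s[of "a - i" 1]]
          biform_mult[OF t[of j 2] t[of "b - j" 1]]]]
    by simp
  have "biform a b (\<lambda>s t. c * (s $ 2 ^ i * s $ 1 ^ (a - i) * (t $ 2 ^ j * t $ 1 ^ (b - j))))"
    if "i \<le> a" "j \<le> b" for c i j
    using monom[of i j c] that by simp
  then have "biform a b (\<lambda>s t. \<Sum>i\<le>a. \<Sum>j\<le>b. Polynomial.coeff (Polynomial.coeff p i) j *
      (s $ 2 ^ i * s $ 1 ^ (a - i) * (t $ 2 ^ j * t $ 1 ^ (b - j))))"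
    by (intro biform_sum) simp
  then show ?thesis
    by (simp add: bihomogenize_def[abs_def] homogenize_def[abs_def] sum_distrib_right sum_distrib_left mult_ac)
qed

text \<open>
  Composing maps multiplies their matrices of bidegrees: this is the functoriality of the Picard
  group of a product of two projective lines, in terms of forms.
\<close>

lemma biform_subst:
  assumes "biform a b \<phi>" and \<Psi>: "\<And>i. biform c d (\<lambda>s t. \<Psi> s t $ i)"
    and \<Theta>: "\<And>i. biform c' d' (\<lambda>s t. \<Theta> s t $ i)"
  shows "biform (a * c + b * c') (a * d + b * d') (\<lambda>s t. \<phi> (\<Psi> s t) (\<Theta> s t))"
  using assms(1)
proof (induction rule: biform.induct)
  case (biform_mult a b \<phi> c d \<psi>)
  from biform.biform_mult[OF biform_mult.IH] show ?case by (simp add: algebra_simps)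
next
  case (biform_fst i)
  show ?case using \<Psi> by simp
next
  case (biform_snd i)
  show ?case using \<Theta> by simp
next
  case (biform_add a b \<phi> \<psi>)
  from biform.biform_add[OF biform_add.IH] show ?case .
next
  case (biform_const c)
  show ?case using biform.biform_const by simp
qed (rule biform_zero)

definition cnjv :: "complex^'n \<Rightarrow> complex^'n" where
  "cnjv v = (\<chi> i. cnj (v $ i))"

lemma cnjv_nth [simp]: "cnjv v $ i = cnj (v $ i)" by (simp add: cnjv_def)
lemma cnjv_cnjv [simp]: "cnjv (cnjv v) = v" by (simp add: vec_eq_iff)
lemma cnjv_eq_0 [simp]: "cnjv v = 0 \<longleftrightarrow> v = 0" by (simp add: vec_eq_iff)

text \<open>
  The real structure of the quadric will turn out to be \<open>(s, t) \<mapsto> (cnj t, cnj s)\<close>, so it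
  exchanges the two degrees.
\<close>

lemma biform_conjugate_swap:
  "biform a b \<phi> \<Longrightarrow> biform b a (\<lambda>s t. cnj (\<phi> (cnjv t) (cnjv s)))"
proof (induction rule: biform.induct)
  case (biform_fst i)
  show ?case using biform_snd[of i] by simp
next
  case (biform_snd i)
  show ?case using biform_fst[of i] by simp
next
  case (biform_add a b \<phi> \<psi>)
  from biform.biform_add[OF biform_add.IH] show ?case by simp
next
  case (biform_mult a b \<phi> c d \<psi>)
  from biform.biform_mult[OF biform_mult.IH] show ?case by simp
qed (simp_all add: biform_const biform_zero)

section \<open>Maps to the projective line that are given locally by forms\<close>

text \<open>
  For nonzero vectors this is equality of the points of the projective line.  It also
  holds if a vector is zero, so that a map given by a pair of forms is proportional to that pair
  everywhere, including the common zeros of the pair.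
\<close>

definition proportional :: "complex^2 \<Rightarrow> complex^2 \<Rightarrow> bool" where
  "proportional u v \<longleftrightarrow> u $ 1 * v $ 2 = u $ 2 * v $ 1"

lemma proportional_sym: "proportional u v \<Longrightarrow> proportional v u"
  by (auto simp: proportional_def algebra_simps)

lemma vec2_eq_0: "(v :: complex^2) = 0 \<longleftrightarrow> v $ 1 = 0 \<and> v $ 2 = 0"
  by (simp add: vec_eq_iff forall_2)

lemma proportional_imp_scale:
  assumes "proportional u v" "v \<noteq> 0" obtains c where "u = c *s v"
proof (cases "v $ 1 = 0")
  case True
  then have "u = (u $ 2 / v $ 2) *s v" using assms by (auto simp: vec_eq_iff forall_2 proportional_def)
  then show ?thesis by (rule that)
next
  case False
  then have "u = (u $ 1 / v $ 1) *s v" using assms by (auto simp: vec_eq_iff forall_2 proportional_def field_simps)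
  then show ?thesis by (rule that)
qed

lemma proportional_trans:
  assumes "proportional u v" "proportional v w" "v \<noteq> 0" shows "proportional u w"
proof -
  obtain c where "u = c *s v" by (rule proportional_imp_scale[OF assms(1,3)])
  then show ?thesis using assms(2) by (simp add: proportional_def)
qed

definition ydeg :: "complex poly poly \<Rightarrow> nat" where
  "ydeg p = Max ((\<lambda>i. degree (Polynomial.coeff p i)) ` {..degree p})"

lemma degree_coeff_le_ydeg: "degree (Polynomial.coeff p i) \<le> ydeg p"
proof (cases "i \<le> degree p")
  case False
  then show ?thesis by (simp add: coeff_eq_0)
qed (auto simp: ydeg_def)

lemma bdeg_le_iff: "bdeg_le a b p \<longleftrightarrow> degree p \<le> a \<and> ydeg p \<le> b"
proof -
  have "ydeg p \<le> b \<longleftrightarrow> (\<forall>i\<le>degree p. degree (Polynomial.coeff p i) \<le> b)"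
    by (auto simp: ydeg_def)
  moreover have "degree (Polynomial.coeff p i) \<le> b" if "ydeg p \<le> b" for i
    using degree_coeff_le_ydeg[of p i] that by (rule order_trans)
  ultimately show ?thesis by (auto simp: bdeg_le_def)
qed

lemma ydeg_attained: "p \<noteq> 0 \<Longrightarrow> \<exists>i. Polynomial.coeff (Polynomial.coeff p i) (ydeg p) \<noteq> 0"
proof (rule ccontr)
  assume p: "p \<noteq> 0" and "\<nexists>i. Polynomial.coeff (Polynomial.coeff p i) (ydeg p) \<noteq> 0"
  then have 0: "Polynomial.coeff (Polynomial.coeff p i) (ydeg p) = 0" for i by blast
  have "ydeg p \<in> (\<lambda>i. degree (Polynomial.coeff p i)) ` {..degree p}"
    unfolding ydeg_def by (rule Max_in) auto
  then obtain i where i: "degree (Polynomial.coeff p i) = ydeg p" by auto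
  have "Polynomial.coeff p i = 0" using 0[of i] i leading_coeff_0_iff by metis
  then have "ydeg p = 0" using i by simp
  then have "Polynomial.coeff p j = 0" for j
    using 0[of j] degree_coeff_le_ydeg[of p j] by (metis leading_coeff_0_iff le_zero_eq)
  then show False using p by (auto simp: poly_eq_iff)
qed

text \<open>
  Homogenizing the coefficients in \<open>y\<close> and evaluating at infinity picks out the coefficient of
  the top power of \<open>y\<close>, a polynomial in \<open>x\<close>.  For a product this is the product of two nonzero
  polynomials, so the top power of \<open>y\<close> cannot drop.
\<close>

lemma ydeg_mult:
  assumes "p \<noteq> 0" "q \<noteq> 0" shows "ydeg p + ydeg q \<le> ydeg (p * q)"
proof (rule ccontr)
  \<comment> \<open>the point at infinity\<close>
  define e :: "complex^2" where "e = axis 2 1"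
  have e: "e $ 1 = 0" "e $ 2 = 1" by (simp_all add: e_def axis_def)
  assume "\<not> ?thesis"
  then have "degree (Polynomial.coeff (p * q) i) < ydeg p + ydeg q" for i
    using degree_coeff_le_ydeg[of "p * q" i] by linarith
  then have "inner_homogenize (ydeg p + ydeg q) (p * q) e = 0"
    by (intro poly_eqI) (simp add: homogenize_at_infinity e coeff_eq_0)
  then have "inner_homogenize (ydeg p) p e = 0 \<or> inner_homogenize (ydeg q) q e = 0"
    using inner_homogenize_mult[of p "ydeg p" q "ydeg q" e] degree_coeff_le_ydeg by simp
  then show False
    using ydeg_attained assms by (auto simp: poly_eq_iff homogenize_at_infinity e)
qed

text \<open>
  For each of the infinitely many constants \<open>x\<close> the polynomials in \<open>y\<close> agree, so every such constant
  is a root of the difference, which a nonzero polynomial over a domain does not allow.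
\<close>

lemma poly_poly_eqI:
  fixes p q :: "complex poly poly"
  assumes "\<And>x y. poly (poly p [:x:]) y = poly (poly q [:x:]) y"
  shows "p = q"
proof (rule ccontr)
  assume "p \<noteq> q"
  then have "finite {z. poly (p - q) z = 0}" using poly_roots_finite[of "p - q"] by simp
  moreover have "range (\<lambda>x. [:x:]) \<subseteq> {z. poly (p - q) z = 0}"
    using assms by (auto simp: poly_eq_poly_eq_iff[symmetric] fun_eq_iff)
  ultimately have "finite (range (\<lambda>x::complex. [:x:]))" by (rule rev_finite_subset)
  then show False using infinite_UNIV_char_0 by (auto dest!: finite_imageD simp: inj_on_def)
qed

lemma bihomogenize_affine:
  assumes "bdeg_le a b p" and s: "s $ 1 = 1" "s $ 2 = x" and t: "t $ 1 = 1" "t $ 2 = y"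
  shows "bihomogenize a b p s t = poly (poly p [:x:]) y"
proof -
  have deg: "degree p \<le> a" "degree (Polynomial.coeff p i) \<le> b" for i
    using assms(1) by (auto simp: bdeg_le_def)
  have "bihomogenize a b p s t = poly (inner_homogenize b p t) x"
    unfolding bihomogenize_def using degree_inner_homogenize[OF assms(1)] s
    by (simp add: homogenize_affine)
  also have "\<dots> = (\<Sum>i\<le>a. poly (Polynomial.coeff p i) y * x ^ i)"
    unfolding poly_eq_sum_atMost[OF degree_inner_homogenize[OF assms(1)]]
    by (simp add: homogenize_affine[OF deg(2)] t)
  also have "\<dots> = poly (poly p [:x:]) y"
    unfolding poly_eq_sum_atMost[OF deg(1)] by (simp add: poly_sum)
  finally show ?thesis .
qed

lemma coprime_cross_mult:
  fixes p q :: "'a::semiring_gcd"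
  assumes "coprime p q" "p * q' = q * p'"
  obtains k where "p' = k * p" "q' = k * q"
proof (cases "p = 0")
  case True
  then have "is_unit q" using assms(1) by simp
  then obtain k where "q' = k * q" by (metis dvd_def mult.commute unit_imp_dvd)
  moreover have "p' = k * p" using True assms(2) \<open>is_unit q\<close> by auto
  ultimately show ?thesis using that by blast
next
  case False
  have "p dvd p'" using assms by (metis coprime_dvd_mult_right_iff dvd_triv_left)
  then obtain k where k: "p' = k * p" by (metis dvd_def mult.commute)
  then have "p * q' = p * (k * q)" using assms(2) by (simp add: mult_ac)
  then show ?thesis using False that k by simp
qed

lemma cross_mult_trans:
  fixes a b p q p' q' :: complex
  assumes "a * q = b * p" "a * q' = b * p'" "a \<noteq> 0 \<or> b \<noteq> 0"
  shows "p * q' = q * p'"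
proof -
  have "a * (p * q') = p * (a * q')" by simp
  also have "\<dots> = (b * p) * p'" by (simp add: assms(2))
  also have "\<dots> = a * (q * p')" by (simp flip: assms(1))
  finally have a: "a * (p * q') = a * (q * p')" .
  have "b * (p * q') = (b * p) * q'" by simp
  also have "\<dots> = q * (a * q')" by (simp flip: assms(1))
  also have "\<dots> = b * (q * p')" by (simp add: assms(2))
  finally have "b * (p * q') = b * (q * p')" .
  with a show ?thesis using assms(3) by auto
qed

text \<open>
  A map to the projective line that is given near each point by some pair of forms is given
  everywhere by one pair without common zeros.  Dehomogenize any local pair and divide it by its
  greatest common divisor, to get a coprime pair \<open>(p, q)\<close>.  Any other local pair
  \<open>(p\<^sub>1, q\<^sub>1)\<close> satisfies \<open>p q\<^sub>1 = q p\<^sub>1\<close>, hence is a multiple \<open>(k p, k q)\<close>.  The degrees of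
  \<open>k\<close> and of \<open>(p, q)\<close> add up to at most those of \<open>(p\<^sub>1, q\<^sub>1)\<close>, so that the identity
  survives homogenization, also at infinity: where the second pair does not vanish, neither does
  the homogenization of \<open>(p, q)\<close>.
\<close>

lemma global_representation:
  assumes h: "\<And>s t. s \<noteq> 0 \<Longrightarrow> t \<noteq> 0 \<Longrightarrow> h s t \<noteq> 0"
    and local: "\<And>s t. s \<noteq> 0 \<Longrightarrow> t \<noteq> 0 \<Longrightarrow>
      \<exists>a b \<Phi>. (\<forall>i. biform a b (\<lambda>s t. \<Phi> s t $ i)) \<and> \<Phi> s t \<noteq> 0 \<and>
        (\<forall>s t. s \<noteq> 0 \<longrightarrow> t \<noteq> 0 \<longrightarrow> proportional (h s t) (\<Phi> s t))"
  obtains a b \<Phi> where "\<And>i. biform a b (\<lambda>s t. \<Phi> s t $ i)"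
    "\<And>s t. s \<noteq> 0 \<Longrightarrow> t \<noteq> 0 \<Longrightarrow> \<Phi> s t \<noteq> 0"
    "\<And>s t. s \<noteq> 0 \<Longrightarrow> t \<noteq> 0 \<Longrightarrow> proportional (h s t) (\<Phi> s t)"
proof -
  define aff :: "complex \<Rightarrow> complex^2" where "aff x = vector [1, x]" for x
  have aff: "aff x $ 1 = 1" "aff x $ 2 = x" "aff x \<noteq> 0" for x
    by (simp_all add: aff_def vec2_eq_0)
  have poly_local: "\<exists>a b p q. bdeg_le a b p \<and> bdeg_le a b q \<and>
      (bihomogenize a b p s t \<noteq> 0 \<or> bihomogenize a b q s t \<noteq> 0) \<and>
      (\<forall>s t. s \<noteq> 0 \<longrightarrow> t \<noteq> 0 \<longrightarrow> h s t $ 1 * bihomogenize a b q s t = h s t $ 2 * bihomogenize a b p s t)"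
    if st: "s \<noteq> 0" "t \<noteq> 0" for s t
  proof -
    obtain a b \<Phi> where \<Phi>: "\<forall>i. biform a b (\<lambda>s t. \<Phi> s t $ i)" "\<Phi> s t \<noteq> 0"
      "\<forall>s t. s \<noteq> 0 \<longrightarrow> t \<noteq> 0 \<longrightarrow> proportional (h s t) (\<Phi> s t)"
      using local[OF st] by (elim exE conjE)
    obtain p where p: "bdeg_le a b p" "\<And>s t. \<Phi> s t $ 1 = bihomogenize a b p s t"
      using biform_imp_bihomogenize[OF \<Phi>(1)[rule_format, of 1]] by blast
    obtain q where q: "bdeg_le a b q" "\<And>s t. \<Phi> s t $ 2 = bihomogenize a b q s t"
      using biform_imp_bihomogenize[OF \<Phi>(1)[rule_format, of 2]] by blast
    show ?thesis
      using \<Phi>(2,3) p q by (intro exI[of _ a] exI[of _ b] exI[of _ p] exI[of _ q]) (auto simp: vec2_eq_0 proportional_def)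
  qed
  note poly_aff = bihomogenize_affine[OF _ aff(1,2) aff(1,2)]
  obtain a0 b0 p0 q0 where 0: "bdeg_le a0 b0 p0" "bdeg_le a0 b0 q0"
    "bihomogenize a0 b0 p0 (aff 0) (aff 0) \<noteq> 0 \<or> bihomogenize a0 b0 q0 (aff 0) (aff 0) \<noteq> 0"
    "\<And>s t. s \<noteq> 0 \<Longrightarrow> t \<noteq> 0 \<Longrightarrow> h s t $ 1 * bihomogenize a0 b0 q0 s t = h s t $ 2 * bihomogenize a0 b0 p0 s t"
    using poly_local[OF aff(3) aff(3), of 0 0] by blast
  have "p0 \<noteq> 0 \<or> q0 \<noteq> 0"
    using 0(3) by (auto simp: bihomogenize_def inner_homogenize_def)
  then have g0: "gcd p0 q0 \<noteq> 0" by simp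
  obtain p q where pq: "p0 = p * gcd p0 q0" "q0 = q * gcd p0 q0" "coprime p q"
    using gcd_coprime_exists[OF g0] by blast
  define a where "a = max (degree p) (degree q)"
  define b where "b = max (ydeg p) (ydeg q)"
  have bdeg: "bdeg_le a b p" "bdeg_le a b q" by (auto simp: bdeg_le_iff a_def b_def)
  define \<Phi> where "\<Phi> s t = (vector [bihomogenize a b p s t, bihomogenize a b q s t] :: complex^2)" for s t
  have \<Phi>: "\<Phi> s t $ 1 = bihomogenize a b p s t" "\<Phi> s t $ 2 = bihomogenize a b q s t" for s t
    by (simp_all add: \<Phi>_def)
  have key: "\<Phi> s t \<noteq> 0 \<and> proportional (h s t) (\<Phi> s t)" if st: "s \<noteq> 0" "t \<noteq> 0" for s t
  proof -
    obtain a1 b1 p1 q1 where 1: "bdeg_le a1 b1 p1" "bdeg_le a1 b1 q1"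
      "bihomogenize a1 b1 p1 s t \<noteq> 0 \<or> bihomogenize a1 b1 q1 s t \<noteq> 0"
      "\<And>s t. s \<noteq> 0 \<Longrightarrow> t \<noteq> 0 \<Longrightarrow> h s t $ 1 * bihomogenize a1 b1 q1 s t = h s t $ 2 * bihomogenize a1 b1 p1 s t"
      using poly_local[OF st] by blast
    have "poly (poly (p0 * q1) [:x:]) y = poly (poly (q0 * p1) [:x:]) y" for x y
    proof -
      let ?h = "h (aff x) (aff y)"
      have "?h $ 1 * poly (poly q0 [:x:]) y = ?h $ 2 * poly (poly p0 [:x:]) y"
        "?h $ 1 * poly (poly q1 [:x:]) y = ?h $ 2 * poly (poly p1 [:x:]) y"
        using 0(4)[OF aff(3) aff(3), of x y] 1(4)[OF aff(3) aff(3), of x y]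
        by (simp_all add: poly_aff[OF 0(1)] poly_aff[OF 0(2)] poly_aff[OF 1(1)] poly_aff[OF 1(2)])
      moreover have "?h $ 1 \<noteq> 0 \<or> ?h $ 2 \<noteq> 0" using h[OF aff(3) aff(3), of x y] by (simp add: vec2_eq_0)
      ultimately have "poly (poly p0 [:x:]) y * poly (poly q1 [:x:]) y = poly (poly q0 [:x:]) y * poly (poly p1 [:x:]) y"
        by (rule cross_mult_trans)
      then show ?thesis by simp
    qed
    then have "p0 * q1 = q0 * p1" by (rule poly_poly_eqI)
    then have "p * q1 * gcd p0 q0 = q * p1 * gcd p0 q0"
      using pq(1,2) by (metis mult.assoc mult.commute)
    then have eq: "p * q1 = q * p1" using g0 by auto
    then obtain k where k: "p1 = k * p" "q1 = k * q" using coprime_cross_mult[OF pq(3)] by blast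
    have "k \<noteq> 0" using 1(3) k by (auto simp: bihomogenize_def inner_homogenize_def)
    have deg: "degree k + degree r \<le> a1 \<and> ydeg k + ydeg r \<le> b1"
      if "bdeg_le a1 b1 (k * r)" "r \<noteq> 0" for r
      using that \<open>k \<noteq> 0\<close> ydeg_mult[of k r] by (auto simp: bdeg_le_iff degree_mult_eq)
    have "p \<noteq> 0 \<or> q \<noteq> 0" using pq g0 by auto
    moreover have "degree k + degree p \<le> a1 \<and> ydeg k + ydeg p \<le> b1" if "p \<noteq> 0"
      using deg[of p] that 1(1) k by simp
    moreover have "degree k + degree q \<le> a1 \<and> ydeg k + ydeg q \<le> b1" if "q \<noteq> 0"
      using deg[of q] that 1(2) k by simp
    \<comment> \<open>One of \<open>p\<close> and \<open>q\<close> may be zero; it has degrees zero and does not affect the maxima.\<close>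
    moreover have "ydeg 0 = 0" by (simp add: ydeg_def)
    ultimately have "degree k + a \<le> a1 \<and> ydeg k + b \<le> b1"
      unfolding a_def b_def by (cases "p = 0"; cases "q = 0") auto
    then have k_deg: "bdeg_le (a1 - a) (b1 - b) k" and ab: "a1 - a + a = a1" "b1 - b + b = b1"
      by (auto simp: bdeg_le_iff)
    define c where "c = bihomogenize (a1 - a) (b1 - b) k s t"
    have c: "bihomogenize a1 b1 p1 s t = c * \<Phi> s t $ 1" "bihomogenize a1 b1 q1 s t = c * \<Phi> s t $ 2"
      using bihomogenize_mult[OF k_deg bdeg(1)] bihomogenize_mult[OF k_deg bdeg(2)]
      by (simp_all add: ab k \<Phi> c_def)
    then have "c \<noteq> 0" "\<Phi> s t \<noteq> 0" using 1(3) by (auto simp: vec2_eq_0)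
    moreover have "proportional (h s t) (\<Phi> s t)"
      using 1(4)[OF st] \<open>c \<noteq> 0\<close> unfolding c by (simp add: proportional_def)
    ultimately show ?thesis by blast
  qed
  show ?thesis
  proof (rule that[of a b \<Phi>])
    have "\<forall>i. biform a b (\<lambda>s t. \<Phi> s t $ i)"
      unfolding forall_2 \<Phi> by (simp add: biform_bihomogenize)
    then show "biform a b (\<lambda>s t. \<Phi> s t $ i)" for i by blast
  qed (use key in auto)
qed

section \<open>Forms without common zeros\<close>

lemma poly_no_root_imp_const:
  fixes p :: "complex poly" assumes "\<And>x. poly p x \<noteq> 0"
  obtains c where "p = [:c:]" "c \<noteq> 0"
proof -
  have "constant (poly p)" using fundamental_theorem_of_algebra assms by blast
  then have "degree p = 0" by (simp add: constant_degree)
  then obtain c where "p = [:c:]" by (rule degree_eq_zeroE)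
  then show ?thesis using that assms[of 0] by auto
qed

text \<open>
  The fundamental theorem of algebra, including the zero at infinity: a polynomial without roots
  is a nonzero constant, whose homogenization vanishes at infinity unless \<open>n = 0\<close>.
\<close>

lemma homogenize_zero_free:
  assumes "degree p \<le> n" "\<And>s. s \<noteq> 0 \<Longrightarrow> homogenize n p s \<noteq> 0"
  shows "n = 0"
proof -
  have "poly p x \<noteq> 0" for x
    using assms(2)[of "vector [1, x]"] homogenize_affine[OF assms(1), of "vector [1, x]"]
    by (simp add: vec2_eq_0)
  then obtain c where "p = [:c:]" by (rule poly_no_root_imp_const)
  moreover have "Polynomial.coeff p n \<noteq> 0"
    using assms(2)[of "vector [0, 1]"] homogenize_at_infinity[of "vector [0, 1]" n p]
    by (simp add: vec2_eq_0)
  ultimately show ?thesis by (auto simp: coeff_pCons split: nat.splits)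
qed

text \<open>
  A morphism of the projective line that is the identity has degree one.  On the affine part
  \<open>q = x p\<close>, so a root of \<open>p\<close> would be a common zero; hence \<open>p\<close> is constant, and having no
  common zero at infinity fixes the formal degree.
\<close>

lemma homogenize_proportional_to_argument:
  assumes deg: "degree p \<le> n" "degree q \<le> n"
    and nz: "\<And>s. s \<noteq> 0 \<Longrightarrow> homogenize n p s \<noteq> 0 \<or> homogenize n q s \<noteq> 0"
    and ratio: "\<And>s. s \<noteq> 0 \<Longrightarrow> homogenize n p s * s $ 2 = homogenize n q s * s $ 1"
  shows "n = 1"
proof -
  have aff: "homogenize n r (vector [1, x]) = poly r x" if "degree r \<le> n" for r x
    using homogenize_affine[OF that, of "vector [1, x]"] by simp
  have at_x: "poly q x = x * poly p x" "poly p x \<noteq> 0 \<or> poly q x \<noteq> 0" for x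
    using nz[of "vector [1, x]"] ratio[of "vector [1, x]"]
    by (simp_all add: aff deg vec2_eq_0 mult.commute)
  then have "poly p x \<noteq> 0" for x by fastforce
  then obtain c where c: "p = [:c:]" "c \<noteq> 0" by (rule poly_no_root_imp_const)
  have "poly q = poly [:0, c:]" using at_x(1) c by (auto simp: fun_eq_iff)
  then have q: "q = [:0, c:]" by (simp only: poly_eq_poly_eq_iff)
  have "Polynomial.coeff p n \<noteq> 0 \<or> Polynomial.coeff q n \<noteq> 0"
    using nz[of "vector [0, 1]"] by (simp add: vec2_eq_0 homogenize_at_infinity)
  then show ?thesis
    using deg(2) c(2) unfolding q c(1) by (auto simp: coeff_pCons split: nat.splits)
qed

lemma biform_slice_fst:
  assumes "biform a b \<phi>" obtains p where "degree p \<le> a" "\<And>s. \<phi> s t = homogenize a p s"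
proof -
  obtain p where p: "bdeg_le a b p" "\<And>s t. \<phi> s t = bihomogenize a b p s t"
    using biform_imp_bihomogenize[OF assms] by blast
  show ?thesis
    by (rule that[OF degree_inner_homogenize[OF p(1)]]) (simp add: p(2) bihomogenize_def)
qed

lemma biform_slice_snd:
  assumes "biform a b \<phi>" obtains p where "degree p \<le> b" "\<And>t. \<phi> s t = homogenize b p t"
proof -
  obtain p where p: "bdeg_le a b p" "\<And>s t. \<phi> s t = bihomogenize a b p s t"
    using biform_imp_bihomogenize[OF assms] by blast
  define q where "q = (\<Sum>i\<le>a. Polynomial.smult (s $ 2 ^ i * s $ 1 ^ (a - i)) (Polynomial.coeff p i))"
  have smult: "homogenize b (Polynomial.smult c r) t = c * homogenize b r t" for c r t
    by (simp add: homogenize_def sum_distrib_left mult_ac)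
  show ?thesis
  proof (rule that[of q])
    show "degree q \<le> b"
      using p(1) unfolding q_def bdeg_le_def
      by (auto intro!: degree_sum_le order_trans[OF degree_smult_le])
    show "\<phi> s t = homogenize b q t" for t
      unfolding p(2) bihomogenize_def q_def homogenize_sum smult
      by (simp add: homogenize_def[of a] mult_ac)
  qed
qed

text \<open>
  If a pair of forms without common zeros represents the projection to the first factor, its
  bidegree is that of the projection.  The two degrees are read off on the two kinds of slices:
  it is the identity in \<open>s\<close> and constant in \<open>t\<close>.
\<close>

lemma biform_pair_proportional_to_fst:
  assumes \<Phi>: "\<And>i. biform a b (\<lambda>s t. \<Phi> s t $ i)"
    and nz: "\<And>s t. s \<noteq> 0 \<Longrightarrow> t \<noteq> 0 \<Longrightarrow> \<Phi> s t \<noteq> 0"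
    and ratio: "\<And>s t. s \<noteq> 0 \<Longrightarrow> t \<noteq> 0 \<Longrightarrow> proportional (\<Phi> s t) s"
  shows "a = 1 \<and> b = 0"
proof
  define e :: "complex^2" where "e = vector [1, 0]"
  have e: "e \<noteq> 0" "e $ 1 = 1" "e $ 2 = 0" by (simp_all add: e_def vec2_eq_0)
  obtain p where p: "degree p \<le> a" "\<And>s. \<Phi> s e $ 1 = homogenize a p s"
    using biform_slice_fst[OF \<Phi>[of 1]] by blast
  obtain q where q: "degree q \<le> a" "\<And>s. \<Phi> s e $ 2 = homogenize a q s"
    using biform_slice_fst[OF \<Phi>[of 2]] by blast
  show "a = 1"
  proof (rule homogenize_proportional_to_argument[OF p(1) q(1)])
    fix s :: "complex^2" assume "s \<noteq> 0"
    then show "homogenize a p s \<noteq> 0 \<or> homogenize a q s \<noteq> 0"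
      "homogenize a p s * s $ 2 = homogenize a q s * s $ 1"
      using nz[OF _ e(1)] ratio[OF _ e(1)] by (auto simp: vec2_eq_0 proportional_def p q)
  qed
  obtain r where r: "degree r \<le> b" "\<And>t. \<Phi> e t $ 1 = homogenize b r t"
    using biform_slice_snd[OF \<Phi>[of 1]] by blast
  show "b = 0"
  proof (rule homogenize_zero_free[OF r(1)])
    fix t :: "complex^2" assume "t \<noteq> 0"
    then show "homogenize b r t \<noteq> 0"
      using nz[OF e(1)] ratio[OF e(1)] by (auto simp: vec2_eq_0 proportional_def r e)
  qed
qed

lemma biform_pair_linear_fst:
  assumes "\<And>i. biform 1 0 (\<lambda>s t. \<Phi> s t $ i)"
  shows "\<exists>A :: complex^2^2. \<forall>s t. \<Phi> s t = A *v s"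
proof -
  have "\<exists>r. \<forall>s t. \<phi> s t = r $ 1 * s $ 1 + (r :: complex^2) $ 2 * s $ 2" if \<phi>: "biform 1 0 \<phi>" for \<phi>
  proof -
    obtain p where "\<And>s t. \<phi> s t = bihomogenize 1 0 p s t"
      using biform_imp_bihomogenize[OF \<phi>] by blast
    then show ?thesis
      by (intro exI[of _ "vector [Polynomial.coeff (Polynomial.coeff p 0) 0, Polynomial.coeff (Polynomial.coeff p 1) 0]"])
        (simp add: bihomogenize_def homogenize_def)
  qed
  then have "\<forall>i. \<exists>r. \<forall>s t. \<Phi> s t $ i = r $ 1 * s $ 1 + (r :: complex^2) $ 2 * s $ 2"
    using assms by blast
  then obtain R where "\<And>i s t. \<Phi> s t $ i = R i $ 1 * s $ 1 + (R i :: complex^2) $ 2 * s $ 2" by metis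
  then show ?thesis
    by (intro exI[of _ "\<chi> i. R i"]) (simp add: vec_eq_iff matrix_vector_mult_def sum_2)
qed

lemma biform_pair_cnj:
  assumes "\<And>i. biform a b (\<lambda>s t. \<Phi> s t $ i)"
  shows "biform b a (\<lambda>s t. cnjv (\<Phi> (cnjv t) (cnjv s)) $ i)"
  using biform_conjugate_swap[OF assms[of i]] by simp

lemma biform_pair_linear_snd:
  assumes "\<And>i. biform 0 1 (\<lambda>s t. \<Phi> s t $ i)"
  shows "\<exists>A :: complex^2^2. \<forall>s t. \<Phi> s t = A *v t"
proof -
  obtain A where A: "\<And>s t. cnjv (\<Phi> (cnjv t) (cnjv s)) = A *v s"
    using biform_pair_linear_fst[OF biform_pair_cnj[OF assms]] by blast
  have "\<Phi> s t = cnjv (A *v cnjv t)" for s t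
    by (metis A cnjv_cnjv)
  then show ?thesis
    by (intro exI[of _ "\<chi> i. cnjv (A $ i)"]) (simp add: vec_eq_iff matrix_vector_mult_def sum_2)
qed

section \<open>The Segre parametrization of the quadric\<close>

lemma real_form_cnjv:
  assumes "real_form d F" shows "F (cnjv v) = cnj (F v)"
proof -
  obtain c where "\<And>v. F v = (\<Sum>\<alpha>\<in>exponents d. of_real (c \<alpha>) * monomial \<alpha> v)"
    using assms unfolding real_form_def by blast
  then show ?thesis by (simp add: monomial_def)
qed

text \<open>
  The combination of the identity and the Pauli matrices with coefficients \<open>v\<close>.  Its determinant
  is the quadratic form \<open>w\<^sup>2 - x\<^sup>2 - y\<^sup>2 - z\<^sup>2\<close>, and it is Hermitian exactly for real vectors.
\<close>

definition mat_of :: "complex^4 \<Rightarrow> complex^2^2" where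
  "mat_of v = vector [vector [v $ 1 + v $ 4, v $ 2 + \<i> * v $ 3],
                      vector [v $ 2 - \<i> * v $ 3, v $ 1 - v $ 4]]"

definition vec_of :: "complex^2^2 \<Rightarrow> complex^4" where
  "vec_of M = vector [(M $ 1 $ 1 + M $ 2 $ 2) / 2, (M $ 1 $ 2 + M $ 2 $ 1) / 2,
                      (M $ 1 $ 2 - M $ 2 $ 1) / (2 * \<i>), (M $ 1 $ 1 - M $ 2 $ 2) / 2]"

definition outer :: "complex^2 \<Rightarrow> complex^2 \<Rightarrow> complex^2^2" where
  "outer s t = (\<chi> i j. s $ i * t $ j)"

definition segre :: "complex^2 \<Rightarrow> complex^2 \<Rightarrow> complex^4" where
  "segre s t = vec_of (outer s t)"

text \<open>
  The Segre parametrization: the point whose matrix has rank one with column space spanned by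
  \<open>s\<close> and row space spanned by \<open>t\<close>.
\<close>

definition pt :: "complex^2 \<Rightarrow> complex^2 \<Rightarrow> (complex^4) set" where
  "pt s t = ppoint (segre s t)"

lemma outer_nth [simp]: "outer s t $ i $ j = s $ i * t $ j"
  by (simp add: outer_def)

lemma mat_of_vec_of [simp]: "mat_of (vec_of M) = M"
  by (simp add: mat_of_def vec_of_def vec_eq_iff forall_2 vector_4_nth field_simps)

lemma vec_of_mat_of [simp]: "vec_of (mat_of v) = v"
  by (simp add: mat_of_def vec_of_def vec_eq_iff forall_4 vector_4_nth field_simps)

lemma mat_of_segre [simp]: "mat_of (segre s t) = outer s t"
  by (simp add: segre_def)

lemma eq_segre_iff: "v = segre s t \<longleftrightarrow> mat_of v = outer s t"
  by (metis mat_of_segre vec_of_mat_of)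

lemma mat_of_eq_0: "mat_of v = 0 \<longleftrightarrow> v = 0"
proof -
  have "mat_of 0 = 0" by (simp add: mat_of_def vec_eq_iff forall_2)
  then show ?thesis by (metis vec_of_mat_of)
qed

lemma mat_of_smult_nth: "mat_of (c *s v) $ i $ j = c * mat_of v $ i $ j"
proof -
  have "\<forall>i j. mat_of (c *s v) $ i $ j = c * mat_of v $ i $ j"
    by (simp add: mat_of_def forall_2 algebra_simps)
  then show ?thesis by blast
qed

lemma mat_of_cnjv_nth: "mat_of (cnjv v) $ i $ j = cnj (mat_of v $ j $ i)"
proof -
  have "\<forall>i j. mat_of (cnjv v) $ i $ j = cnj (mat_of v $ j $ i)"
    by (simp add: mat_of_def forall_2)
  then show ?thesis by blast
qed

lemma cone_iff_det: "v \<in> quadric_cone \<longleftrightarrow> v \<noteq> 0 \<and> det (mat_of v) = 0"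
proof -
  have "det (mat_of v) = (v $ 1)\<^sup>2 - ((v $ 2)\<^sup>2 + (v $ 3)\<^sup>2 + (v $ 4)\<^sup>2)"
    by (simp add: det_2 mat_of_def power2_eq_square algebra_simps)
  then show ?thesis by (auto simp: quadric_cone_def)
qed

lemma segre_eq_0: "segre s t = 0 \<longleftrightarrow> s = 0 \<or> t = 0"
  by (subst mat_of_eq_0[symmetric]) (auto simp: vec_eq_iff forall_2)

lemma segre_in_cone: "s \<noteq> 0 \<Longrightarrow> t \<noteq> 0 \<Longrightarrow> segre s t \<in> quadric_cone"
  by (simp add: cone_iff_det segre_eq_0 det_2)

lemma segre_smult: "segre (a *s s) (b *s t) = (a * b) *s segre s t"
  by (simp add: segre_def vec_of_def vec_eq_iff forall_4 vector_4_nth field_simps)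

text \<open>
  Conjugating a vector is taking the Hermitian transpose of its matrix, which exchanges the two
  factors of a matrix of rank one.
\<close>

lemma segre_cnjv: "segre (cnjv t) (cnjv s) = cnjv (segre s t)"
proof -
  have "cnjv (segre s t) = segre (cnjv t) (cnjv s)"
    unfolding eq_segre_iff by (simp add: vec_eq_iff mat_of_cnjv_nth)
  then show ?thesis ..
qed

text \<open>
  A nonzero singular matrix has rank one.  Both columns are multiples of a nonzero column, and the
  multipliers form the second factor.
\<close>

lemma cone_imp_segre:
  assumes "v \<in> quadric_cone"
  obtains s t where "s \<noteq> 0" "t \<noteq> 0" "v = segre s t"
proof -
  let ?M = "mat_of v"
  have M: "?M \<noteq> 0" "?M $ 1 $ 1 * ?M $ 2 $ 2 = ?M $ 1 $ 2 * ?M $ 2 $ 1"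
    using assms by (auto simp: cone_iff_det mat_of_eq_0 det_2)
  define s where "s j = (\<chi> i. ?M $ i $ j)" for j
  have proportional: "proportional (s 2) (s 1)" using M(2) by (simp add: s_def proportional_def algebra_simps)
  have *: "v = segre u t \<longleftrightarrow> s 1 = t $ 1 *s u \<and> s 2 = t $ 2 *s u" for u t
    unfolding eq_segre_iff by (auto simp: s_def vec_eq_iff forall_2 mult.commute)
  show ?thesis
  proof (cases "s 1 = 0")
    case True
    then have "s 2 \<noteq> 0" using M(1) by (auto simp: s_def vec_eq_iff forall_2)
    then show ?thesis using True by (intro that[of "s 2" "vector [0, 1]"]) (simp_all add: * vec2_eq_0)
  next
    case False
    obtain c where "s 2 = c *s s 1" by (rule proportional_imp_scale[OF proportional False])
    then show ?thesis using False by (intro that[of "s 1" "vector [1, c]"]) (simp_all add: * vec2_eq_0)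
  qed
qed

lemma pt_in_quadric: "s \<noteq> 0 \<Longrightarrow> t \<noteq> 0 \<Longrightarrow> pt s t \<in> quadric"
  by (simp add: pt_def quadric_def segre_in_cone)

lemma quadric_cases:
  assumes "p \<in> quadric" obtains s t where "s \<noteq> 0" "t \<noteq> 0" "p = pt s t"
proof -
  obtain v where "v \<in> quadric_cone" "p = ppoint v" using assms by (auto simp: quadric_def)
  then show ?thesis using cone_imp_segre that by (metis pt_def)
qed

text \<open>
  The first parameter of a point can be read off from any column of its matrix.  Near a given
  point some fixed column is nonzero, which provides the local representation of the first
  parameter by forms.
\<close>

lemma ppoint_eq_pt_imp_proportional:
  assumes "v \<noteq> 0" "s \<noteq> 0" "t \<noteq> 0" "ppoint v = pt s t"
  shows "proportional s (\<chi> i. mat_of v $ i $ j)"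
proof -
  obtain c where c: "c \<noteq> 0" "v = c *s segre s t"
    using assms ppoint_eq_iff[of v "segre s t"] by (auto simp: pt_def segre_eq_0)
  then show ?thesis by (simp add: proportional_def mat_of_smult_nth)
qed

lemma pt_eq_iff:
  assumes "s \<noteq> 0" "t \<noteq> 0" "s' \<noteq> 0" "t' \<noteq> 0"
  shows "pt s t = pt s' t' \<longleftrightarrow> proportional s s' \<and> proportional t t'"
proof
  assume "proportional s s' \<and> proportional t t'"
  then obtain a b where "s = a *s s'" "t = b *s t'" using assms proportional_imp_scale by metis
  moreover from this have "a * b \<noteq> 0" using assms by auto
  ultimately have "\<exists>c. c \<noteq> 0 \<and> segre s t = c *s segre s' t'" using segre_smult by blast
  then show "pt s t = pt s' t'"
    using assms ppoint_eq_iff[of "segre s t" "segre s' t'"] by (simp add: pt_def segre_eq_0)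
next
  assume eq: "pt s t = pt s' t'"
  then obtain c where "c \<noteq> 0" "segre s t = c *s segre s' t'"
    using assms ppoint_eq_iff[of "segre s t" "segre s' t'"] by (auto simp: pt_def segre_eq_0)
  then have *: "s $ i * t $ j = c * (s' $ i * t' $ j)" for i j
    using mat_of_smult_nth[of c "segre s' t'" i j] by (metis mat_of_segre outer_nth)
  obtain j where j: "t $ j \<noteq> 0" using assms(2) by (auto simp: vec_eq_iff)
  have "(s $ 1 * t $ j) * s' $ 2 = (s $ 2 * t $ j) * s' $ 1" unfolding * by simp
  then have "proportional s s'" using j by (simp add: proportional_def)
  moreover obtain i where i: "s $ i \<noteq> 0" using assms(1) by (auto simp: vec_eq_iff)
  have "(s $ i * t $ 1) * t' $ 2 = (s $ i * t $ 2) * t' $ 1" unfolding * by simp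
  then have "proportional t t'" using i by (simp add: proportional_def)
  ultimately show "proportional s s' \<and> proportional t t'" by blast
qed

section \<open>Regular maps in Segre coordinates\<close>

lemma biform_segre: "biform 1 1 (\<lambda>s t. segre s t $ k)"
proof -
  have o: "biform 1 1 (\<lambda>s t. c * (s $ i * t $ j))" for c i j
    using biform_scale[OF biform_mult[OF biform_fst[of i] biform_snd[of j]], of c] by simp
  have "biform 1 1 (\<lambda>s t. c * (s $ i * t $ j) + d * (s $ i' * t $ j'))" for c d i j i' j'
    by (rule biform_add[OF o o])
  note l = this
  have "\<forall>k. biform 1 1 (\<lambda>s t. segre s t $ k)"
    using l[of "1/2" 1 1 "1/2" 2 2] l[of "1/2" 1 2 "1/2" 2 1]
      l[of "1/(2*\<i>)" 1 2 "-1/(2*\<i>)" 2 1] l[of "1/2" 1 1 "-1/2" 2 2]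
    unfolding forall_4 by (simp add: segre_def vec_of_def vector_4_nth add_divide_distrib diff_divide_distrib right_diff_distrib)
  then show ?thesis by blast
qed

lemma biform_real_form:
  assumes "real_form d F" shows "biform d d (\<lambda>s t. F (segre s t))"
proof -
  obtain c where c: "\<And>v. F v = (\<Sum>\<alpha>\<in>exponents d. of_real (c \<alpha>) * monomial \<alpha> v)"
    using assms unfolding real_form_def by blast
  have "biform d d (\<lambda>s t. monomial \<alpha> (segre s t))" if "\<alpha> \<in> exponents d" for \<alpha>
  proof -
    have "biform (\<Sum>i\<in>UNIV. \<alpha> i * 1) (\<Sum>i\<in>UNIV. \<alpha> i * 1) (\<lambda>s t. \<Prod>i\<in>UNIV. segre s t $ i ^ \<alpha> i)"
      by (intro biform_prod biform_power biform_segre) simp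
    then show ?thesis using that by (simp add: monomial_def exponents_def)
  qed
  then show ?thesis unfolding c by (intro biform_sum biform_scale)
qed

lemma biform_mat_of:
  assumes "\<And>k. real_form d (\<lambda>v. F v $ k)"
  shows "biform d d (\<lambda>s t. mat_of (F (segre s t)) $ i $ j)"
proof -
  note b = biform_real_form[OF assms]
  have l: "biform d d (\<lambda>s t. F (segre s t) $ k + c * F (segre s t) $ l)" for c k l
    by (rule biform_add[OF b biform_scale[OF b]])
  have "\<forall>i j. biform d d (\<lambda>s t. mat_of (F (segre s t)) $ i $ j)"
    using l[of 1 1 4] l[of 2 \<i> 3] l[of 2 "-\<i>" 3] l[of 1 "-1" 4]
    unfolding forall_2 by (simp add: mat_of_def)
  then show ?thesis by blast
qed

text \<open>
  The first parameter of \<open>f\<close> is given by one pair \<open>\<Phi>\<close> of forms without common zeros.  As \<open>f\<close> is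
  given by real forms, it commutes with the real structure, which exchanges the parameters; so
  the second parameter is the conjugate of the first one at the conjugate point.
\<close>

lemma regular_global_form:
  assumes f: "regular_over_reals f"
  shows "\<exists>a b \<Phi>. (\<forall>i. biform a b (\<lambda>s t. \<Phi> s t $ i)) \<and>
    (\<forall>s t. s \<noteq> 0 \<longrightarrow> t \<noteq> 0 \<longrightarrow>
      \<Phi> s t \<noteq> 0 \<and> f (pt s t) = pt (\<Phi> s t) (cnjv (\<Phi> (cnjv t) (cnjv s))))"
proof -
  have ex: "\<exists>u w. s \<noteq> 0 \<longrightarrow> t \<noteq> 0 \<longrightarrow> u \<noteq> 0 \<and> w \<noteq> 0 \<and> f (pt s t) = pt u w" for s t
  proof (cases "s = 0 \<or> t = 0")
    case False
    then have "f (pt s t) \<in> quadric"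
      using f pt_in_quadric by (auto simp: regular_over_reals_def)
    then show ?thesis by (rule quadric_cases) auto
  qed auto
  from ex have "\<forall>s t. \<exists>u w. s \<noteq> 0 \<longrightarrow> t \<noteq> 0 \<longrightarrow> u \<noteq> 0 \<and> w \<noteq> 0 \<and> f (pt s t) = pt u w"
    by blast
  then have "\<exists>h k. \<forall>s t. s \<noteq> 0 \<longrightarrow> t \<noteq> 0 \<longrightarrow>
      h s t \<noteq> 0 \<and> k s t \<noteq> 0 \<and> f (pt s t) = pt (h s t) (k s t)"
    by (simp only: choice_iff)
  then obtain h k where "\<forall>s t. s \<noteq> 0 \<longrightarrow> t \<noteq> 0 \<longrightarrow>
      h s t \<noteq> 0 \<and> k s t \<noteq> 0 \<and> f (pt s t) = pt (h s t) (k s t)"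
    by (elim exE)
  then have hk: "\<And>s t. s \<noteq> 0 \<Longrightarrow> t \<noteq> 0 \<Longrightarrow> h s t \<noteq> 0"
    "\<And>s t. s \<noteq> 0 \<Longrightarrow> t \<noteq> 0 \<Longrightarrow> k s t \<noteq> 0"
    "\<And>s t. s \<noteq> 0 \<Longrightarrow> t \<noteq> 0 \<Longrightarrow> f (pt s t) = pt (h s t) (k s t)"
    by simp_all
  have rep: "\<exists>d F. (\<forall>i. real_form d (\<lambda>u. F u $ i)) \<and> F (segre s t) \<noteq> 0 \<and>
        (\<forall>u\<in>quadric_cone. F u \<noteq> 0 \<longrightarrow> f (ppoint u) = ppoint (F u))"
    if "s \<noteq> 0" "t \<noteq> 0" for s t
    using f segre_in_cone[OF that] unfolding regular_over_reals_def by blast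
  obtain a b \<Phi> where \<Phi>: "\<And>i. biform a b (\<lambda>s t. \<Phi> s t $ i)"
    "\<And>s t. s \<noteq> 0 \<Longrightarrow> t \<noteq> 0 \<Longrightarrow> \<Phi> s t \<noteq> 0"
    "\<And>s t. s \<noteq> 0 \<Longrightarrow> t \<noteq> 0 \<Longrightarrow> proportional (h s t) (\<Phi> s t)"
  proof (rule global_representation[of h])
    fix s t :: "complex^2" assume st: "s \<noteq> 0" "t \<noteq> 0"
    obtain d F where F: "\<And>i. real_form d (\<lambda>u. F u $ i)" "F (segre s t) \<noteq> 0"
      "\<And>u. u \<in> quadric_cone \<Longrightarrow> F u \<noteq> 0 \<Longrightarrow> f (ppoint u) = ppoint (F u)"
      using rep[OF st] by blast
    \<comment> \<open>The column \<open>j\<close> is chosen for this point only; where it vanishes it is proportional to everything.\<close>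
    obtain i j where ij: "mat_of (F (segre s t)) $ i $ j \<noteq> 0"
      using F(2) mat_of_eq_0 by (metis vec_eq_iff zero_index)
    define \<Psi> where "\<Psi> s t = (\<chi> i. mat_of (F (segre s t)) $ i $ j)" for s t
    have "\<forall>i. biform d d (\<lambda>s t. \<Psi> s t $ i)"
      by (simp add: \<Psi>_def biform_mat_of F(1))
    moreover have "\<Psi> s t \<noteq> 0" using ij by (auto simp: \<Psi>_def vec_eq_iff)
    moreover have "proportional (h s t) (\<Psi> s t)" if "s \<noteq> 0" "t \<noteq> 0" for s t
    proof (cases "F (segre s t) = 0")
      case True
      then have "\<Psi> s t = 0" by (simp add: \<Psi>_def vec_eq_iff mat_of_eq_0[THEN iffD2])
      then show ?thesis by (simp add: proportional_def)
    next
      case False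
      then have "ppoint (F (segre s t)) = pt (h s t) (k s t)"
        using F(3)[OF segre_in_cone[OF that]] hk(3)[OF that] by (simp add: pt_def)
      then show ?thesis
        using ppoint_eq_pt_imp_proportional[OF False hk(1)[OF that] hk(2)[OF that]] by (simp add: \<Psi>_def)
    qed
    ultimately show "\<exists>a b \<Phi>. (\<forall>i. biform a b (\<lambda>s t. \<Phi> s t $ i)) \<and> \<Phi> s t \<noteq> 0 \<and>
        (\<forall>s t. s \<noteq> 0 \<longrightarrow> t \<noteq> 0 \<longrightarrow> proportional (h s t) (\<Phi> s t))" by blast
  qed (use hk(1) in auto)
  have conj: "f (pt (cnjv t) (cnjv s)) = pt (cnjv (k s t)) (cnjv (h s t))"
    if st: "s \<noteq> 0" "t \<noteq> 0" for s t
  proof -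
    obtain d F where F: "\<And>i. real_form d (\<lambda>u. F u $ i)" "F (segre s t) \<noteq> 0"
      "\<And>u. u \<in> quadric_cone \<Longrightarrow> F u \<noteq> 0 \<Longrightarrow> f (ppoint u) = ppoint (F u)"
      using rep[OF st] by blast
    have F_cnjv: "F (cnjv u) = cnjv (F u)" for u
      using real_form_cnjv[OF F(1)] by (simp add: vec_eq_iff)
    have nz: "segre (h s t) (k s t) \<noteq> 0" using hk(1,2) st by (simp add: segre_eq_0)
    have "ppoint (F (segre s t)) = ppoint (segre (h s t) (k s t))"
      using F(3)[OF segre_in_cone[OF st] F(2)] hk(3)[OF st] by (simp add: pt_def)
    then obtain c where c: "c \<noteq> 0" "F (segre s t) = c *s segre (h s t) (k s t)"
      using ppoint_eq_iff[OF F(2) nz] by blast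
    have "cnjv (F (segre s t)) = cnj c *s segre (cnjv (k s t)) (cnjv (h s t))"
      unfolding c(2) segre_cnjv by (simp add: vec_eq_iff)
    then have "ppoint (cnjv (F (segre s t))) = pt (cnjv (k s t)) (cnjv (h s t))"
      using c(1) F(2) nz ppoint_eq_iff[of "cnjv (F (segre s t))" "segre (cnjv (k s t)) (cnjv (h s t))"]
      unfolding pt_def segre_cnjv by auto
    moreover have "f (pt (cnjv t) (cnjv s)) = ppoint (F (cnjv (segre s t)))"
      using F(3)[of "cnjv (segre s t)"] F(2) segre_in_cone[of "cnjv t" "cnjv s"] st
      by (simp add: pt_def segre_cnjv F_cnjv)
    ultimately show ?thesis by (simp add: F_cnjv)
  qed
  show ?thesis
  proof (rule exI[of _ a], rule exI[of _ b], rule exI[of _ \<Phi>], intro conjI allI impI)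
    show "biform a b (\<lambda>s t. \<Phi> s t $ i)" for i by (rule \<Phi>(1))
    fix s t :: "complex^2" assume st: "s \<noteq> 0" "t \<noteq> 0"
    show "\<Phi> s t \<noteq> 0" by (rule \<Phi>(2)[OF st])
    let ?s = "cnjv t" and ?t = "cnjv s"
    have st': "?s \<noteq> 0" "?t \<noteq> 0" using st by auto
    have "pt (h ?s ?t) (k ?s ?t) = pt (cnjv (k s t)) (cnjv (h s t))"
      using conj[OF st] hk(3)[OF st'] by simp
    then have "proportional (cnjv (k s t)) (h ?s ?t)"
      using pt_eq_iff[of "h ?s ?t" "k ?s ?t" "cnjv (k s t)" "cnjv (h s t)"] hk(1,2) st st' proportional_sym by auto
    then have "proportional (cnjv (k s t)) (\<Phi> ?s ?t)"
      using \<Phi>(3)[OF st'] hk(1)[OF st'] proportional_trans by blast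
    then have "proportional (k s t) (cnjv (\<Phi> ?s ?t))"
      by (simp add: proportional_def complex_eq_iff)
    then show "f (pt s t) = pt (\<Phi> s t) (cnjv (\<Phi> ?s ?t))"
      using \<Phi>(2,3) hk st st' pt_eq_iff[of "h s t" "k s t" "\<Phi> s t" "cnjv (\<Phi> ?s ?t)"] by auto
  qed
qed

section \<open>The automorphisms of the quadric\<close>

definition cnjm :: "complex^2^2 \<Rightarrow> complex^2^2" where
  "cnjm A = (\<chi> i j. cnj (A $ i $ j))"

lemma cnjm_nth [simp]: "cnjm A $ i $ j = cnj (A $ i $ j)"
  by (simp add: cnjm_def)

lemma cnjm_cnjm [simp]: "cnjm (cnjm A) = A" by (simp add: vec_eq_iff)

lemma cnjm_mult: "cnjm (A ** B) = cnjm A ** cnjm B"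
  by (simp add: vec_eq_iff matrix_matrix_mult_def)

lemma cnjv_mult_vec: "cnjv (A *v s) = cnjm A *v cnjv s"
  by (simp add: vec_eq_iff matrix_vector_mult_def)

lemma det_cnjm: "det (cnjm A) = cnj (det A)"
  by (simp add: det_2)

lemma mult_vec_nonzero:
  fixes A :: "complex^2^2" assumes "det A \<noteq> 0" "s \<noteq> 0" shows "A *v s \<noteq> 0"
  using assms invertible_det_nz[of A] matrix_left_invertible_ker[of A]
  by (auto simp: invertible_def)

lemma det_nonzero_if_injective:
  fixes A :: "complex^2^2" assumes "\<And>s. s \<noteq> 0 \<Longrightarrow> A *v s \<noteq> 0" shows "det A \<noteq> 0"
  using assms invertible_det_nz[of A] matrix_left_invertible_ker[of A] invertible_left_inverse[of A]
  by blast

text \<open>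
  The action \<open>M \<mapsto> A M A\<^sup>*\<close> of \<open>A\<close> on matrices, carried over to vectors.  It preserves Hermitian
  matrices, so its components are real linear forms, and it preserves the vanishing of the
  determinant: this is the homomorphism from the linear group to the automorphisms of the quadric.
\<close>

definition hermitian_act :: "complex^2^2 \<Rightarrow> complex^4 \<Rightarrow> complex^4" where
  "hermitian_act A v = vec_of (A ** mat_of v ** transpose (cnjm A))"

lemma outer_act: "A ** outer s t ** transpose B = outer (A *v s) (B *v t)"
  by (simp add: vec_eq_iff forall_2 matrix_matrix_mult_def matrix_vector_mult_def sum_2
      transpose_def algebra_simps)

lemma hermitian_act_segre: "hermitian_act A (segre s t) = segre (A *v s) (cnjm A *v t)"
  by (simp add: hermitian_act_def outer_act segre_def)

text \<open>
  A complex linear functional that commutes with conjugation is real on the unit vectors, and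
  these values are its coefficients.
\<close>

lemma real_form_linear:
  assumes add: "\<And>u v. l (u + v) = l u + l v" and scale: "\<And>c v. l (c *s v) = c * l v"
    and cnj: "\<And>v. l (cnjv v) = cnj (l v)"
  shows "real_form 1 l"
proof -
  have zero: "l 0 = 0" using scale[of 0 0] by simp
  have sum: "l (\<Sum>x\<in>A. g x) = (\<Sum>x\<in>A. l (g x))" for A and g :: "4 \<Rightarrow> complex^4"
    by (induction A rule: infinite_finite_induct) (auto simp: zero add)
  have "cnjv (axis i 1) = axis i 1" for i :: 4 by (simp add: vec_eq_iff axis_def)
  then have "cnj (l (axis i 1)) = l (axis i 1)" for i by (metis cnj)
  then have real: "of_real (Re (l (axis i 1))) = l (axis i 1)" for i
    by (simp add: complex_eq_iff)
  have "v = (\<Sum>i\<in>UNIV. v $ i *s axis i 1)" for v :: "complex^4"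
    by (simp add: vec_eq_iff axis_def if_distrib cong: if_cong)
  then have "l v = (\<Sum>i\<in>UNIV. of_real (Re (l (axis i 1))) * v $ i)" for v
    by (metis (no_types, lifting) sum sum.cong scale real mult.commute)
  then have "l = (\<lambda>v. \<Sum>i\<in>UNIV. of_real (Re (l (axis i 1))) * v $ i)" by blast
  moreover have "real_form 1 \<dots>"
    by (intro real_form_sum real_form_scale real_form_coord)
  ultimately show ?thesis by simp
qed

lemma mat_of_add: "mat_of (u + v) = mat_of u + mat_of v"
  by (simp add: mat_of_def vec_eq_iff forall_2 algebra_simps)

lemma matrix_add_rdistrib:
  fixes A B :: "'a::semiring_1^'n^'m" and C :: "'a^'k^'n"
  shows "(A + B) ** C = A ** C + B ** C"
  by (simp add: vec_eq_iff matrix_matrix_mult_def distrib_right sum.distrib)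

lemma vec_of_add: "vec_of (M + N) = vec_of M + vec_of N"
  by (simp add: vec_of_def vec_eq_iff forall_4 vector_4_nth field_simps)

lemma hermitian_act_add: "hermitian_act A (u + v) = hermitian_act A u + hermitian_act A v"
  by (simp add: hermitian_act_def mat_of_add vec_of_add matrix_add_ldistrib matrix_add_rdistrib)

lemma mat_of_inject: "mat_of u = mat_of v \<Longrightarrow> u = v"
  by (metis vec_of_mat_of)

lemma mat_of_hermitian_act: "mat_of (hermitian_act A v) = A ** mat_of v ** transpose (cnjm A)"
  by (simp add: hermitian_act_def)

lemma hermitian_act_smult: "hermitian_act A (c *s v) = c *s hermitian_act A v"
proof (rule mat_of_inject)
  show "mat_of (hermitian_act A (c *s v)) = mat_of (c *s hermitian_act A v)"
    by (simp add: vec_eq_iff mat_of_smult_nth mat_of_hermitian_act matrix_matrix_mult_def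
        sum_distrib_left sum_distrib_right mult_ac)
qed

lemma hermitian_act_cnjv: "hermitian_act A (cnjv v) = cnjv (hermitian_act A v)"
proof (rule mat_of_inject)
  show "mat_of (hermitian_act A (cnjv v)) = mat_of (cnjv (hermitian_act A v))"
    by (simp add: vec_eq_iff forall_2 mat_of_cnjv_nth mat_of_hermitian_act matrix_matrix_mult_def
        transpose_def sum_2 algebra_simps)
qed

lemma real_form_hermitian_act: "real_form 1 (\<lambda>v. hermitian_act A v $ i)"
  by (rule real_form_linear) (simp_all add: hermitian_act_add hermitian_act_smult hermitian_act_cnjv)

lemma hermitian_act_mult: "hermitian_act A (hermitian_act B v) = hermitian_act (A ** B) v"
  by (rule mat_of_inject) (simp add: mat_of_hermitian_act cnjm_mult matrix_transpose_mul matrix_mul_assoc)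

lemma hermitian_act_1: "hermitian_act (mat 1) v = v"
proof -
  have "cnjm (mat 1) = mat 1" by (simp add: vec_eq_iff mat_def)
  then show ?thesis by (simp add: hermitian_act_def)
qed

lemma hermitian_act_cone:
  assumes "det A \<noteq> 0" "v \<in> quadric_cone" shows "hermitian_act A v \<in> quadric_cone"
proof -
  obtain s t where "s \<noteq> 0" "t \<noteq> 0" "v = segre s t" using assms(2) by (rule cone_imp_segre)
  then show ?thesis
    using assms(1) by (simp add: hermitian_act_segre segre_in_cone mult_vec_nonzero det_cnjm)
qed

lemma hermitian_act_in_Aut:
  assumes "det A \<noteq> 0" shows "induced (hermitian_act A) \<in> carrier Aut_quadric"
proof -
  obtain B where B: "A ** B = mat 1" "B ** A = mat 1"
    using assms invertible_det_nz[of A] by (auto simp: invertible_def)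
  then have "det A * det B = 1" by (metis det_mul det_I)
  then have "det B \<noteq> 0" by auto
  then show ?thesis
    by (intro induced_in_Aut_quadric[of _ "hermitian_act B"])
      (auto simp: real_form_hermitian_act[unfolded One_nat_def] hermitian_act_cone assms hermitian_act_mult B hermitian_act_1)
qed

lemma induced_hermitian_act_pt:
  assumes "s \<noteq> 0" "t \<noteq> 0"
  shows "induced (hermitian_act A) (pt s t) = pt (A *v s) (cnjm A *v t)"
  unfolding pt_def
  using induced_ppoint[of "hermitian_act A" "segre s t"] assms
  by (simp add: real_form_hermitian_act[unfolded One_nat_def] segre_in_cone hermitian_act_segre)

text \<open>
  The automorphisms that preserve and those that exchange the two rulings by lines.  The action
  on one parameter determines the other by compatibility with the real structure.
\<close>

definition acts_by :: "((complex^4) set \<Rightarrow> (complex^4) set) \<Rightarrow> complex^2^2 \<Rightarrow> bool" where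
  "acts_by f A \<longleftrightarrow>
     (\<forall>s t. s \<noteq> 0 \<longrightarrow> t \<noteq> 0 \<longrightarrow> f (pt s t) = pt (A *v s) (cnjm A *v t))"

definition swaps_by :: "((complex^4) set \<Rightarrow> (complex^4) set) \<Rightarrow> complex^2^2 \<Rightarrow> bool" where
  "swaps_by f B \<longleftrightarrow>
     (\<forall>s t. s \<noteq> 0 \<longrightarrow> t \<noteq> 0 \<longrightarrow> f (pt s t) = pt (B *v t) (cnjm B *v s))"

text \<open>
  Let the first parameter of \<open>f\<close> have bidegree \<open>(a, b)\<close> and that of its inverse \<open>(a', b')\<close>.
  Composing, the projection to the first factor has bidegree \<open>(a a' + b b', a b' + b a')\<close>, which
  must be \<open>(1, 0)\<close>.  In natural numbers this leaves only \<open>(1, 0)\<close> and \<open>(0, 1)\<close> for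
  \<open>(a, b)\<close>, and forms of these bidegrees are linear in one of the parameters.
\<close>

theorem Aut_quadric_cases:
  assumes "f \<in> carrier Aut_quadric"
  obtains (preserving) A where "det A \<noteq> 0" "acts_by f A"
    | (swapping) B where "det B \<noteq> 0" "swaps_by f B"
proof -
  have reg: "regular_over_reals f" "regular_over_reals (inv_into quadric f)"
    and bij: "bij_betw f quadric quadric"
    using assms by (auto simp: Aut_quadric_def Bij_def)
  obtain a b \<Phi> where "(\<forall>i. biform a b (\<lambda>s t. \<Phi> s t $ i)) \<and>
    (\<forall>s t. s \<noteq> 0 \<longrightarrow> t \<noteq> 0 \<longrightarrow>
      \<Phi> s t \<noteq> 0 \<and> f (pt s t) = pt (\<Phi> s t) (cnjv (\<Phi> (cnjv t) (cnjv s))))"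
    using regular_global_form[OF reg(1)] by (elim exE)
  then have \<Phi>: "\<And>i. biform a b (\<lambda>s t. \<Phi> s t $ i)"
    "\<And>s t. s \<noteq> 0 \<Longrightarrow> t \<noteq> 0 \<Longrightarrow> \<Phi> s t \<noteq> 0"
    "\<And>s t. s \<noteq> 0 \<Longrightarrow> t \<noteq> 0 \<Longrightarrow> f (pt s t) = pt (\<Phi> s t) (cnjv (\<Phi> (cnjv t) (cnjv s)))"
    by simp_all
  obtain a' b' \<Psi> where "(\<forall>i. biform a' b' (\<lambda>s t. \<Psi> s t $ i)) \<and>
    (\<forall>s t. s \<noteq> 0 \<longrightarrow> t \<noteq> 0 \<longrightarrow>
      \<Psi> s t \<noteq> 0 \<and> inv_into quadric f (pt s t) = pt (\<Psi> s t) (cnjv (\<Psi> (cnjv t) (cnjv s))))"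
    using regular_global_form[OF reg(2)] by (elim exE)
  then have \<Psi>: "\<And>i. biform a' b' (\<lambda>s t. \<Psi> s t $ i)"
    "\<And>s t. s \<noteq> 0 \<Longrightarrow> t \<noteq> 0 \<Longrightarrow> \<Psi> s t \<noteq> 0"
    "\<And>s t. s \<noteq> 0 \<Longrightarrow> t \<noteq> 0 \<Longrightarrow> inv_into quadric f (pt s t) = pt (\<Psi> s t) (cnjv (\<Psi> (cnjv t) (cnjv s)))"
    by simp_all
  define \<Psi>' where "\<Psi>' s t = cnjv (\<Psi> (cnjv t) (cnjv s))" for s t
  have \<Psi>': "\<And>i. biform b' a' (\<lambda>s t. \<Psi>' s t $ i)" "\<And>s t. s \<noteq> 0 \<Longrightarrow> t \<noteq> 0 \<Longrightarrow> \<Psi>' s t \<noteq> 0"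
    using biform_pair_cnj[OF \<Psi>(1)] \<Psi>(2) by (auto simp: \<Psi>'_def[abs_def])
  have "a * a' + b * b' = 1 \<and> a * b' + b * a' = 0"
  proof (rule biform_pair_proportional_to_fst)
    show "biform (a * a' + b * b') (a * b' + b * a') (\<lambda>s t. \<Phi> (\<Psi> s t) (\<Psi>' s t) $ i)" for i
      using biform_subst[OF \<Phi>(1)[of i] \<Psi>(1) \<Psi>'(1)] .
    fix s t :: "complex^2" assume st: "s \<noteq> 0" "t \<noteq> 0"
    show nz: "\<Phi> (\<Psi> s t) (\<Psi>' s t) \<noteq> 0"
      by (rule \<Phi>(2)[OF \<Psi>(2)[OF st] \<Psi>'(2)[OF st]])
    have nz': "cnjv (\<Phi> (cnjv (\<Psi>' s t)) (cnjv (\<Psi> s t))) \<noteq> 0"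
      using \<Phi>(2)[of "cnjv (\<Psi>' s t)" "cnjv (\<Psi> s t)"] \<Psi>(2)[OF st] \<Psi>'(2)[OF st] by simp
    have "f (inv_into quadric f (pt s t)) = pt s t"
      using bij pt_in_quadric[OF st] by (metis bij_betw_def f_inv_into_f)
    then have "pt (\<Phi> (\<Psi> s t) (\<Psi>' s t)) (cnjv (\<Phi> (cnjv (\<Psi>' s t)) (cnjv (\<Psi> s t)))) = pt s t"
      using \<Phi>(3)[OF \<Psi>(2)[OF st] \<Psi>'(2)[OF st]] \<Psi>(3)[OF st] by (simp add: \<Psi>'_def)
    then show "proportional (\<Phi> (\<Psi> s t) (\<Psi>' s t)) s"
      using pt_eq_iff[OF nz nz' st] by simp
  qed
  then have "(a = 1 \<and> b = 0) \<or> (a = 0 \<and> b = 1)"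
    by (cases "a = 0"; cases "b = 0"; auto simp: add_is_1)
  then show ?thesis
  proof (elim disjE conjE)
    assume "a = 1" "b = 0"
    then have "biform 1 0 (\<lambda>s t. \<Phi> s t $ i)" for i using \<Phi>(1)[of i] by simp
    then obtain A where A: "\<And>s t. \<Phi> s t = A *v s" using biform_pair_linear_fst[of \<Phi>] by auto
    show ?thesis
    proof (rule preserving)
      show "det A \<noteq> 0"
      proof (rule det_nonzero_if_injective)
        show "A *v s \<noteq> 0" if "s \<noteq> 0" for s using \<Phi>(2)[OF that that] by (simp add: A)
      qed
      show "acts_by f A" using \<Phi>(3) by (simp add: acts_by_def A cnjv_mult_vec)
    qed
  next
    assume "a = 0" "b = 1"
    then have "biform 0 1 (\<lambda>s t. \<Phi> s t $ i)" for i using \<Phi>(1)[of i] by simp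
    then obtain B where B: "\<And>s t. \<Phi> s t = B *v t" using biform_pair_linear_snd[of \<Phi>] by auto
    show ?thesis
    proof (rule swapping)
      show "det B \<noteq> 0"
      proof (rule det_nonzero_if_injective)
        show "B *v s \<noteq> 0" if "s \<noteq> 0" for s using \<Phi>(2)[OF that that] by (simp add: B)
      qed
      show "swaps_by f B" using \<Phi>(3) by (simp add: swaps_by_def B cnjv_mult_vec)
    qed
  qed
qed

section \<open>Conjugacy and twisted conjugacy of two-by-two matrices\<close>

lemma proportional_smult: "a *s u = b *s v \<Longrightarrow> a \<noteq> 0 \<Longrightarrow> proportional u v"
proof -
  assume "a *s u = b *s v" "a \<noteq> 0"
  then have "a * u $ i = b * v $ i" for i by (metis vector_smult_component)
  then have "a * (u $ 1 * v $ 2) = a * (u $ 2 * v $ 1)"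
    by (simp add: mult.assoc[symmetric])
  then show "proportional u v" using \<open>a \<noteq> 0\<close> by (simp add: proportional_def)
qed

lemma mult_vec_2:
  "((A :: complex^2^2) *v s) $ i = A $ i $ 1 * s $ 1 + A $ i $ 2 * s $ 2"
  by (simp add: matrix_vector_mult_def sum_2)

lemma mat_mult_2:
  "((A :: complex^2^2) ** B) $ i $ j = A $ i $ 1 * B $ 1 $ j + A $ i $ 2 * B $ 2 $ j"
  by (simp add: matrix_matrix_mult_def sum_2)

lemma mat2_nth [simp]:
  "(mat k :: complex^2^2) $ 1 $ 1 = k" "(mat k :: complex^2^2) $ 1 $ 2 = 0"
  "(mat k :: complex^2^2) $ 2 $ 1 = 0" "(mat k :: complex^2^2) $ 2 $ 2 = k"
  by (simp_all add: mat_def)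

lemma mat_mult_vec: "(mat k :: complex^2^2) *v s = k *s s"
  by (simp add: vec_eq_iff forall_2 mult_vec_2)

lemma scalar_if_all_proportional:
  assumes "\<And>s. s \<noteq> 0 \<Longrightarrow> proportional (A *v s) s" obtains k where "A = mat k"
proof -
  have "A $ 2 $ 1 = 0" "A $ 1 $ 2 = 0" "A $ 1 $ 1 = A $ 2 $ 2"
    using assms[of "vector [1, 0]"] assms[of "vector [0, 1]"] assms[of "vector [1, 1]"]
    by (auto simp: proportional_def mult_vec_2 vec2_eq_0)
  then show ?thesis by (intro that[of "A $ 1 $ 1"]) (simp add: vec_eq_iff forall_2)
qed

text \<open>
  Since \<open>A - l\<close> is singular, \<open>(A\<^sub>2\<^sub>1, l - A\<^sub>1\<^sub>1)\<close> and \<open>(l - A\<^sub>2\<^sub>2, A\<^sub>1\<^sub>2)\<close> are annihilated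
  by it from the left.  If both vanish, then so does \<open>A - l\<close>.
\<close>

lemma left_eigenvector:
  fixes A :: "complex^2^2"
  assumes "(A $ 1 $ 1 - l) * (A $ 2 $ 2 - l) = A $ 1 $ 2 * A $ 2 $ 1"
  shows "\<exists>r :: complex^2. r \<noteq> 0 \<and>
    (\<forall>s. r $ 1 * (A *v s) $ 1 + r $ 2 * (A *v s) $ 2 = l * (r $ 1 * s $ 1 + r $ 2 * s $ 2))"
proof -
  have crit: ?thesis
    if "r \<noteq> 0" "r $ 1 * A $ 1 $ 1 + r $ 2 * A $ 2 $ 1 = l * r $ 1"
      "r $ 1 * A $ 1 $ 2 + r $ 2 * A $ 2 $ 2 = l * r $ 2" for r :: "complex^2"
  proof (intro exI[of _ r] conjI allI)
    show "r \<noteq> 0" by (rule that(1))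
    fix s :: "complex^2"
    have "r $ 1 * (A *v s) $ 1 + r $ 2 * (A *v s) $ 2 =
       (r $ 1 * A $ 1 $ 1 + r $ 2 * A $ 2 $ 1) * s $ 1 + (r $ 1 * A $ 1 $ 2 + r $ 2 * A $ 2 $ 2) * s $ 2"
      by (simp add: mult_vec_2 algebra_simps)
    then show "r $ 1 * (A *v s) $ 1 + r $ 2 * (A *v s) $ 2 = l * (r $ 1 * s $ 1 + r $ 2 * s $ 2)"
      unfolding that(2,3) by (simp add: algebra_simps)
  qed
  consider "A $ 2 $ 1 \<noteq> 0 \<or> A $ 1 $ 1 \<noteq> l" | "A $ 1 $ 2 \<noteq> 0 \<or> A $ 2 $ 2 \<noteq> l"
    | "A $ 2 $ 1 = 0" "A $ 1 $ 1 = l" "A $ 1 $ 2 = 0" "A $ 2 $ 2 = l" by blast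
  then show ?thesis
  proof cases
    case 1
    then show ?thesis
      using assms by (intro crit[of "vector [A $ 2 $ 1, l - A $ 1 $ 1]"]) (auto simp: vec2_eq_0 algebra_simps)
  next
    case 2
    then show ?thesis
      using assms by (intro crit[of "vector [l - A $ 2 $ 2, A $ 1 $ 2]"]) (auto simp: vec2_eq_0 algebra_simps)
  next
    case 3
    then show ?thesis by (intro crit[of "vector [1, 0]"]) (auto simp: vec2_eq_0)
  qed
qed

text \<open>
  This is the diagonalizability of an element of finite order of the projective linear group.
  With distinct eigenvalues the left eigenvectors are the rows of the diagonalizing matrix, and
  evaluating the power at the vector with coordinates \<open>(1, 1)\<close> shows that the powers of the
  eigenvalues agree.  With a double eigenvalue \<open>l\<close> write \<open>A = l + N\<close> with \<open>N\<^sup>2 = 0\<close>; then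
  \<open>A\<^sup>n = l\<^sup>n + n l\<^sup>n\<^sup>-\<^sup>1 N\<close> is scalar in characteristic zero only if \<open>N\<close> is.
\<close>

lemma scalar_or_diagonalizable:
  fixes A :: "complex^2^2"
  assumes n: "n > 0" and det: "det A \<noteq> 0" and pow: "\<forall>s. s \<noteq> 0 \<longrightarrow> proportional (((*v) A ^^ n) s) s"
  obtains (scalar) k where "A = mat k"
  | (diagonal) C l m where "det C \<noteq> 0" "m \<noteq> 0" "l ^ n = m ^ n"
      "\<And>s. C *v (A *v s) = vector [l * (C *v s) $ 1, m * (C *v s) $ 2]"
proof -
  let ?tr = "A $ 1 $ 1 + A $ 2 $ 2"
  define d where "d = csqrt (?tr\<^sup>2 - 4 * det A)"
  define l m where "l = (?tr + d) / 2" and "m = (?tr - d) / 2"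
  have d2: "d\<^sup>2 = ?tr\<^sup>2 - 4 * det A" by (simp add: d_def)
  have sum: "l + m = ?tr" by (simp add: l_def m_def field_simps)
  have "4 * (l * m) = ?tr\<^sup>2 - d\<^sup>2" by (simp add: l_def m_def power2_eq_square field_simps)
  then have prod: "l * m = det A" using d2 by simp
  have lm: "l \<noteq> 0" "m \<noteq> 0" using prod det by auto
  have char: "(A $ 1 $ 1 - x) * (A $ 2 $ 2 - x) - A $ 1 $ 2 * A $ 2 $ 1 = (x - l) * (x - m)" for x
  proof -
    have "(x - l) * (x - m) = x * x - (l + m) * x + l * m" by (simp add: algebra_simps)
    then show ?thesis unfolding sum prod det_2 by (simp add: algebra_simps)
  qed
  show thesis
  proof (cases "l = m")
    case True
    define N where "N = A - mat l"
    have N: "A *v s = l *s s + N *v s" for s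
      by (simp add: N_def vec_eq_iff forall_2 mult_vec_2 algebra_simps)
    have NN: "N *v (N *v s) = 0" for s
    proof -
      have "N $ 1 $ 1 + N $ 2 $ 2 = 0" using sum True by (simp add: N_def algebra_simps)
      then have tr: "N $ 2 $ 2 = - N $ 1 $ 1" by (simp add: eq_neg_iff_add_eq_0 add.commute)
      have "N $ 1 $ 1 * N $ 2 $ 2 = N $ 1 $ 2 * N $ 2 $ 1"
        using char[of l] by (simp add: N_def)
      then have "N $ 1 $ 2 * N $ 2 $ 1 = - (N $ 1 $ 1 * N $ 1 $ 1)" using tr by simp
      then show ?thesis
        by (simp add: tr vec_eq_iff forall_2 mult_vec_2 algebra_simps)
    qed
    have AN: "A *v (N *v s) = l *s (N *v s)" for s using N[of "N *v s"] NN by simp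
    \<comment> \<open>Multiplying by \<open>l\<close> avoids the exponent \<open>j - 1\<close>, which is wrong for \<open>j = 0\<close> in natural numbers.\<close>
    have iter: "l *s ((*v) A ^^ j) s = l ^ Suc j *s s + (of_nat j * l ^ j) *s (N *v s)" for j s
    proof (induction j)
      case (Suc j)
      have "l *s ((*v) A ^^ Suc j) s = A *v (l *s ((*v) A ^^ j) s)"
        by (simp add: vec_eq_iff mult_vec_2 algebra_simps)
      also have "\<dots> = l ^ Suc j *s (A *v s) + (of_nat j * l ^ j) *s (A *v (N *v s))"
        unfolding Suc.IH by (simp add: vec_eq_iff mult_vec_2 algebra_simps)
      also have "\<dots> = l ^ Suc (Suc j) *s s + (of_nat (Suc j) * l ^ Suc j) *s (N *v s)"
        unfolding AN unfolding N[of s] by (simp add: vec_eq_iff algebra_simps)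
      finally show ?case .
    qed simp
    have "proportional (N *v s) s" if s: "s \<noteq> 0" for s
    proof -
      obtain c where c: "((*v) A ^^ n) s = c *s s" using proportional_imp_scale[OF pow[rule_format, OF s] s] by blast
      have "(of_nat n * l ^ n) *s (N *v s) = (l * c - l ^ Suc n) *s s"
        using iter[of n s] unfolding c by (simp add: vec_eq_iff algebra_simps)
      moreover have "of_nat n * l ^ n \<noteq> 0" using n lm by simp
      ultimately show ?thesis by (rule proportional_smult)
    qed
    then obtain k where "N = mat k" using scalar_if_all_proportional by blast
    then have "A = mat (l + k)" by (simp add: N_def vec_eq_iff forall_2 algebra_simps)
    then show thesis by (rule scalar)
  next
    case False
    have "(A $ 1 $ 1 - l) * (A $ 2 $ 2 - l) = A $ 1 $ 2 * A $ 2 $ 1"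
      "(A $ 1 $ 1 - m) * (A $ 2 $ 2 - m) = A $ 1 $ 2 * A $ 2 $ 1"
      using char[of l] char[of m] by simp_all
    then obtain r q :: "complex^2" where "r \<noteq> 0 \<and>
        (\<forall>s. r $ 1 * (A *v s) $ 1 + r $ 2 * (A *v s) $ 2 = l * (r $ 1 * s $ 1 + r $ 2 * s $ 2))"
      "q \<noteq> 0 \<and>
        (\<forall>s. q $ 1 * (A *v s) $ 1 + q $ 2 * (A *v s) $ 2 = m * (q $ 1 * s $ 1 + q $ 2 * s $ 2))"
      using left_eigenvector[of A l] left_eigenvector[of A m] by (elim exE meta_impE) auto
    then have r: "r \<noteq> 0"
      "\<And>s. r $ 1 * (A *v s) $ 1 + r $ 2 * (A *v s) $ 2 = l * (r $ 1 * s $ 1 + r $ 2 * s $ 2)"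
      and q: "q \<noteq> 0"
      "\<And>s. q $ 1 * (A *v s) $ 1 + q $ 2 * (A *v s) $ 2 = m * (q $ 1 * s $ 1 + q $ 2 * s $ 2)"
      by blast+
    define C :: "complex^2^2" where "C = vector [r, q]"
    have CA: "C *v (A *v s) = vector [l * (C *v s) $ 1, m * (C *v s) $ 2]" for s
      using r(2)[of s] q(2)[of s] by (simp add: C_def vec_eq_iff forall_2 mult_vec_2)
    have detC: "det C \<noteq> 0"
    proof
      assume "det C = 0"
      then have "proportional q r" by (simp add: det_2 C_def proportional_def algebra_simps)
      then obtain c where c: "q = c *s r" using proportional_imp_scale r(1) by blast
      then have "c \<noteq> 0" using q(1) by auto
      have "(l - m) * (r $ 1 * s $ 1 + r $ 2 * s $ 2) = 0" for s :: "complex^2"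
      proof -
        have "c * (l * (r $ 1 * s $ 1 + r $ 2 * s $ 2)) = q $ 1 * (A *v s) $ 1 + q $ 2 * (A *v s) $ 2"
          unfolding r(2)[symmetric] c by (simp add: algebra_simps)
        also have "\<dots> = c * (m * (r $ 1 * s $ 1 + r $ 2 * s $ 2))"
          unfolding q(2) unfolding c by (simp add: algebra_simps)
        finally have "c * (l * (r $ 1 * s $ 1 + r $ 2 * s $ 2)) = \<dots>" .
        then have "l * (r $ 1 * s $ 1 + r $ 2 * s $ 2) = m * (r $ 1 * s $ 1 + r $ 2 * s $ 2)"
          by (simp only: mult_left_cancel[OF \<open>c \<noteq> 0\<close>])
        then show ?thesis by (simp only: left_diff_distrib) simp
      qed
      from this[of "vector [1, 0]"] this[of "vector [0, 1]"] show False
        using False r(1) by (simp add: vec2_eq_0)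
    qed
    have iter: "C *v (((*v) A ^^ j) s) = vector [l ^ j * (C *v s) $ 1, m ^ j * (C *v s) $ 2]" for j s
      by (induction j) (simp_all add: CA vec_eq_iff forall_2)
    have "l ^ n = m ^ n"
    proof -
      obtain D where D: "C ** D = mat 1" using detC invertible_det_nz[of C] by (auto simp: invertible_def)
      define s where "s = D *v vector [1, 1]"
      have Cs: "C *v s = vector [1, 1]" by (simp add: s_def matrix_vector_mul_assoc D)
      have "s \<noteq> 0"
      proof
        assume "s = 0"
        then have "(vector [1, 1] :: complex^2) = 0" using Cs by simp
        then show False by (simp add: vec2_eq_0)
      qed
      then obtain c where "((*v) A ^^ n) s = c *s s" using proportional_imp_scale[OF pow[rule_format]] by blast
      then have "C *v (((*v) A ^^ n) s) = c *s vector [1, 1]"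
        by (simp add: Cs[symmetric] vec_eq_iff mult_vec_2 algebra_simps)
      then show ?thesis unfolding iter Cs by (simp add: vec_eq_iff forall_2)
    qed
    then show thesis using diagonal[OF detC lm(2) _ CA] by blast
  qed
qed

text \<open>
  The averaging argument of Hilbert's Theorem 90.  The matrix \<open>A\<^sub>X = X + e B\<^sub>0 (cnj X) (cnj B)\<close>
  intertwines for every \<open>X\<close>, because applying the twist twice gives \<open>e\<^sup>2 = 1\<close>.  It remains to make it
  invertible, and a scalar \<open>X = \<mu>\<close> is enough: the determinant is a quadratic form in \<open>\<mu>\<close> and
  \<open>cnj \<mu>\<close> with coefficient one at \<open>\<mu>\<^sup>2\<close>, so it does not vanish for all \<open>\<mu>\<close>.
\<close>

lemma swapped_conjugator:
  fixes B B\<^sub>0 :: "complex^2^2"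
  assumes e: "e = 1 \<or> e = - 1" and B: "B ** cnjm B = mat e" and B0: "B\<^sub>0 ** cnjm B\<^sub>0 = mat e"
  obtains A where "det A \<noteq> 0" "A ** B = B\<^sub>0 ** cnjm A"
proof -
  \<comment> \<open>\<open>A \<mu>\<close> is the average for the scalar matrix \<open>X = \<mu>\<close>.\<close>
  define K where "K = B\<^sub>0 ** cnjm B"
  define A where "A \<mu> = (\<chi> i j. (mat \<mu> :: complex^2^2) $ i $ j + e * cnj \<mu> * K $ i $ j)" for \<mu>
  have cnj_e: "cnj e = e" "e * e = 1" using e by auto
  have ee: "e * (e * x) = x" for x using cnj_e(2) by (simp flip: mult.assoc)
  have BB: "cnjm B ** B = mat e"
  proof -
    have "cnjm (B ** cnjm B) = mat e" unfolding B using cnj_e by (simp add: vec_eq_iff forall_2)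
    then show ?thesis by (simp add: cnjm_mult)
  qed
  then have KB: "K ** B = (\<chi> i j. e * B\<^sub>0 $ i $ j)"
    unfolding K_def matrix_mul_assoc[symmetric] BB by (simp add: vec_eq_iff forall_2 mat_mult_2)
  have B0K: "B\<^sub>0 ** cnjm K = (\<chi> i j. e * B $ i $ j)"
    unfolding K_def cnjm_mult cnjm_cnjm matrix_mul_assoc B0
    by (simp add: vec_eq_iff forall_2 mat_mult_2)
  have intertwines: "A \<mu> ** B = B\<^sub>0 ** cnjm (A \<mu>)" for \<mu>
  proof -
    have "A \<mu> ** B = (\<chi> i j. \<mu> * B $ i $ j + e * cnj \<mu> * (K ** B) $ i $ j)"
      by (simp add: A_def vec_eq_iff forall_2 mat_mult_2 algebra_simps)
    also have "\<dots> = (\<chi> i j. cnj \<mu> * B\<^sub>0 $ i $ j + e * \<mu> * (B\<^sub>0 ** cnjm K) $ i $ j)"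
      unfolding KB B0K by (simp add: vec_eq_iff ee mult_ac)
    also have "\<dots> = B\<^sub>0 ** cnjm (A \<mu>)"
      using cnj_e by (simp add: A_def vec_eq_iff forall_2 mat_mult_2 algebra_simps)
    finally show ?thesis .
  qed
  have det: "det (A \<mu>) = \<mu>\<^sup>2 + \<mu> * cnj \<mu> * (e * (K $ 1 $ 1 + K $ 2 $ 2)) + (cnj \<mu>)\<^sup>2 * det K" for \<mu>
  proof -
    have "det (A \<mu>) = \<mu>\<^sup>2 + \<mu> * cnj \<mu> * (e * (K $ 1 $ 1 + K $ 2 $ 2)) + (e * e) * (cnj \<mu>)\<^sup>2 * det K"
      by (simp add: A_def det_2 power2_eq_square algebra_simps)
    then show ?thesis using cnj_e by simp
  qed
  have "\<exists>\<mu>. det (A \<mu>) \<noteq> 0"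
  proof (rule ccontr)
    assume "\<not> ?thesis"
    then have 0: "det (A \<mu>) = 0" for \<mu> by blast
    define T D where "T = e * (K $ 1 $ 1 + K $ 2 $ 2)" and "D = det K"
    note det' = det[folded T_def D_def, unfolded 0]
    \<comment> \<open>Three values of \<open>\<mu>\<close> whose ratios \<open>cnj \<mu> / \<mu>\<close> are \<open>1\<close>, \<open>-1\<close> and \<open>\<i>\<close> suffice.\<close>
    have "1 + T + D = 0" using det'[of 1] by simp
    moreover have "- 1 + T - D = 0" using det'[of \<i>] by simp
    moreover have "- 2 * \<i> + 2 * T + 2 * \<i> * D = 0"
    proof -
      have "(1 - \<i>)\<^sup>2 = - 2 * \<i>" "(1 - \<i>) * cnj (1 - \<i>) = 2" "(cnj (1 - \<i>))\<^sup>2 = 2 * \<i>"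
        by (simp_all add: power2_eq_square complex_eq_iff)
      with det'[of "1 - \<i>"] show ?thesis by (metis (no_types))
    qed
    moreover have "2 * T = (1 + T + D) + (- 1 + T - D)" "D = (1 + T + D) - T - 1" by simp_all
    ultimately have "T = 0" "D = - 1" "- 2 * \<i> + 2 * T + 2 * \<i> * D = 0" by auto
    then show False by (simp add: complex_eq_iff)
  qed
  then show ?thesis using that intertwines by blast
qed

section \<open>Elements of prime order\<close>

lemma Aut_mem_quadric: "f \<in> carrier Aut_quadric \<Longrightarrow> p \<in> quadric \<Longrightarrow> f p \<in> quadric"
  by (auto simp: Aut_quadric_def Bij_def bij_betw_def)

lemma Aut_mult_apply:
  assumes "f \<in> carrier Aut_quadric" "g \<in> carrier Aut_quadric" "p \<in> quadric"
  shows "(f \<otimes>\<^bsub>Aut_quadric\<^esub> g) p = f (g p)"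
  using assms by (auto simp: Aut_quadric_def BijGroup_def compose_def)

lemma Aut_eqI:
  assumes "f \<in> carrier Aut_quadric" "g \<in> carrier Aut_quadric"
    and "\<And>s t. s \<noteq> 0 \<Longrightarrow> t \<noteq> 0 \<Longrightarrow> f (pt s t) = g (pt s t)"
  shows "f = g"
proof (rule extensionalityI[of _ quadric])
  show "f \<in> extensional quadric" "g \<in> extensional quadric"
    using assms by (auto simp: Aut_quadric_def Bij_def)
  show "f p = g p" if "p \<in> quadric" for p
    using quadric_cases[OF that] assms(3) by metis
qed

lemma Aut_one_apply: "p \<in> quadric \<Longrightarrow> \<one>\<^bsub>Aut_quadric\<^esub> p = p"
  by (simp add: Aut_quadric_def BijGroup_def)

lemma Aut_pow_apply:
  assumes f: "f \<in> carrier Aut_quadric" and p: "p \<in> quadric"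
  shows "(f [^]\<^bsub>Aut_quadric\<^esub> (n::nat)) p = (f ^^ n) p"
proof -
  interpret group Aut_quadric by (rule group_Aut_quadric)
  show ?thesis
    using p
  proof (induction n arbitrary: p)
    case (Suc n)
    have "(f [^]\<^bsub>Aut_quadric\<^esub> Suc n) p = (f [^]\<^bsub>Aut_quadric\<^esub> n) (f p)"
      using Aut_mult_apply[OF nat_pow_closed[OF f] f Suc.prems] by simp
    then show ?case using Suc.IH[OF Aut_mem_quadric[OF f Suc.prems]] by (simp add: funpow_swap1)
  qed (simp add: Aut_one_apply)
qed

lemma conjugateI:
  assumes "f \<in> carrier Aut_quadric" "g \<in> carrier Aut_quadric" "det A \<noteq> 0"
    and eq: "\<And>s t. s \<noteq> 0 \<Longrightarrow> t \<noteq> 0 \<Longrightarrow>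
      induced (hermitian_act A) (f (pt s t)) = g (pt (A *v s) (cnjm A *v t))"
  shows "conjugate_in Aut_quadric f g"
proof -
  interpret group Aut_quadric by (rule group_Aut_quadric)
  let ?h = "induced (hermitian_act A)"
  have h: "?h \<in> carrier Aut_quadric" by (rule hermitian_act_in_Aut[OF assms(3)])
  have "?h \<otimes>\<^bsub>Aut_quadric\<^esub> f = g \<otimes>\<^bsub>Aut_quadric\<^esub> ?h"
  proof (rule Aut_eqI)
    fix s t :: "complex^2" assume "s \<noteq> 0" "t \<noteq> 0"
    then show "(?h \<otimes>\<^bsub>Aut_quadric\<^esub> f) (pt s t) = (g \<otimes>\<^bsub>Aut_quadric\<^esub> ?h) (pt s t)"
      using h assms(1,2) eq by (simp add: Aut_mult_apply pt_in_quadric induced_hermitian_act_pt)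
  qed (use h assms in auto)
  then have "?h \<otimes>\<^bsub>Aut_quadric\<^esub> f \<otimes>\<^bsub>Aut_quadric\<^esub> inv\<^bsub>Aut_quadric\<^esub> ?h = g"
    using h assms(1,2) by (simp add: m_assoc)
  then show ?thesis using h unfolding conjugate_in_def by blast
qed

lemma rotation_pt:
  assumes "s \<noteq> 0" "t \<noteq> 0"
  shows "rotation \<theta> (pt s t) = pt (vector [cis \<theta> * s $ 1, s $ 2]) (vector [cnj (cis \<theta>) * t $ 1, t $ 2])"
proof -
  let ?L = "\<lambda>v :: complex^4. vector
     [v $ 1, v $ 2 * of_real (cos \<theta>) - v $ 3 * of_real (sin \<theta>),
      v $ 2 * of_real (sin \<theta>) + v $ 3 * of_real (cos \<theta>), v $ 4] :: complex^4"
  have cis: "cis \<theta> = of_real (cos \<theta>) + \<i> * of_real (sin \<theta>)"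
    "cnj (cis \<theta>) = of_real (cos \<theta>) - \<i> * of_real (sin \<theta>)"
    by (simp_all add: complex_eq_iff)
  have unit: "cis \<theta> * cnj (cis \<theta>) = 1" by (simp add: cis_cnj cis_mult)
  have forms: "\<forall>i. real_form 1 (\<lambda>u. ?L u $ i)"
    unfolding forall_4 vector_4_nth by (intro conjI linear_form_intros)
  have "mat_of (?L v) = vector [vector [mat_of v $ 1 $ 1, cis \<theta> * mat_of v $ 1 $ 2],
      vector [cnj (cis \<theta>) * mat_of v $ 2 $ 1, mat_of v $ 2 $ 2]]" for v
    unfolding cis by (simp add: mat_of_def vector_4_nth vec_eq_iff forall_2 algebra_simps)
  then have "?L (segre s t) = segre (vector [cis \<theta> * s $ 1, s $ 2]) (vector [cnj (cis \<theta>) * t $ 1, t $ 2])"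
    unfolding eq_segre_iff using unit by (simp add: vec_eq_iff forall_2)
  then show ?thesis
    using induced_ppoint[of ?L "segre s t"] forms segre_in_cone[OF assms]
    by (simp add: rotation_def pt_def)
qed

lemma swaps_by_reflection:
  fixes D :: "complex^2^2"
  assumes D: "D = vector [vector [1, 0], vector [0, -1]]"
  shows "swaps_by reflection D"
  unfolding swaps_by_def
proof (intro allI impI)
  fix s t :: "complex^2" assume st: "s \<noteq> 0" "t \<noteq> 0"
  let ?L = "\<lambda>v :: complex^4. vector [v $ 1, - v $ 2, v $ 3, v $ 4] :: complex^4"
  have forms: "\<forall>i. real_form 1 (\<lambda>u. ?L u $ i)"
    unfolding forall_4 vector_4_nth by (intro conjI linear_form_intros)
  have "mat_of (?L v) = vector [vector [mat_of v $ 1 $ 1, - mat_of v $ 2 $ 1],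
      vector [- mat_of v $ 1 $ 2, mat_of v $ 2 $ 2]]" for v
    by (simp add: mat_of_def vector_4_nth vec_eq_iff forall_2 algebra_simps)
  then have "?L (segre s t) = segre (D *v t) (cnjm D *v s)"
    unfolding eq_segre_iff by (simp add: vec_eq_iff forall_2 D mult_vec_2)
  then show "reflection (pt s t) = pt (D *v t) (cnjm D *v s)"
    using induced_ppoint[of ?L "segre s t"] forms segre_in_cone[OF st]
    by (simp add: reflection_def pt_def)
qed

text \<open>
  On matrices the antipodal involution is the negative of the adjugate, that is
  \<open>M \<mapsto> J M\<^sup>T J\<close>.
\<close>

lemma swaps_by_antipodal:
  fixes J :: "complex^2^2"
  assumes J: "J = vector [vector [0, 1], vector [-1, 0]]"
  shows "swaps_by antipodal J"
  unfolding swaps_by_def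
proof (intro allI impI)
  fix s t :: "complex^2" assume st: "s \<noteq> 0" "t \<noteq> 0"
  let ?L = "\<lambda>v :: complex^4. vector [- v $ 1, v $ 2, v $ 3, v $ 4] :: complex^4"
  have forms: "\<forall>i. real_form 1 (\<lambda>u. ?L u $ i)"
    unfolding forall_4 vector_4_nth by (intro conjI linear_form_intros)
  have "mat_of (?L v) = vector [vector [- mat_of v $ 2 $ 2, mat_of v $ 1 $ 2],
      vector [mat_of v $ 2 $ 1, - mat_of v $ 1 $ 1]]" for v
    by (simp add: mat_of_def vector_4_nth vec_eq_iff forall_2 algebra_simps)
  then have L: "?L (segre s t) = segre (J *v t) (-1 *s (cnjm J *v s))"
    unfolding eq_segre_iff by (simp add: vec_eq_iff forall_2 J mult_vec_2)
  have "det J \<noteq> 0" by (simp add: J det_2)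
  then have nz: "J *v t \<noteq> 0" "cnjm J *v s \<noteq> 0" using st by (simp_all add: mult_vec_nonzero det_cnjm)
  have "antipodal (pt s t) = pt (J *v t) (-1 *s (cnjm J *v s))"
    using induced_ppoint[of ?L "segre s t"] forms segre_in_cone[OF st] L
    by (simp add: antipodal_def pt_def)
  also have "\<dots> = pt (J *v t) (cnjm J *v s)"
    using nz by (subst pt_eq_iff) (auto simp: proportional_def)
  finally show "antipodal (pt s t) = pt (J *v t) (cnjm J *v s)" .
qed

text \<open>
  The matrix is diagonalizable with eigenvalue ratio a root of unity \<open>cis \<theta>\<close>, and
  \<open>M \<mapsto> D M D\<^sup>*\<close> with \<open>D\<close> the diagonal matrix with entries \<open>cis \<theta>\<close> and \<open>1\<close> multiplies the
  coordinate \<open>x + \<i> y\<close> by \<open>cis \<theta>\<close> and fixes \<open>w\<close> and \<open>z\<close>.  A scalar matrix would give the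
  identity, whose order is not prime.
\<close>

lemma prime_order_preserving:
  assumes f: "f \<in> carrier Aut_quadric" and ord: "prime (group.ord Aut_quadric f)"
    and det: "det A \<noteq> 0"
    and acts: "acts_by f A"
  shows "\<exists>\<theta>\<in>{0..<2 * pi}. conjugate_in Aut_quadric f (rotation \<theta>)"
proof -
  interpret group Aut_quadric by (rule group_Aut_quadric)
  have fA: "f (pt s t) = pt (A *v s) (cnjm A *v t)" if "s \<noteq> 0" "t \<noteq> 0" for s t
    using acts that by (simp add: acts_by_def)
  define n where "n = group.ord Aut_quadric f"
  have n: "n > 0" using ord by (simp add: n_def prime_gt_0_nat)
  have nz: "A *v s \<noteq> 0" "cnjm A *v s \<noteq> 0" if "s \<noteq> 0" for s
    using that det by (simp_all add: mult_vec_nonzero det_cnjm)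
  have iter: "(f ^^ j) (pt s t) = pt (((*v) A ^^ j) s) (((*v) (cnjm A) ^^ j) t) \<and>
      ((*v) A ^^ j) s \<noteq> 0 \<and> ((*v) (cnjm A) ^^ j) t \<noteq> 0" if "s \<noteq> 0" "t \<noteq> 0" for s t j
    using that by (induction j) (auto simp: fA nz)
  have "f [^]\<^bsub>Aut_quadric\<^esub> n = \<one>\<^bsub>Aut_quadric\<^esub>"
    unfolding n_def by (rule pow_ord_eq_1[OF f])
  then have "(f ^^ n) (pt s t) = pt s t" if "s \<noteq> 0" "t \<noteq> 0" for s t
    using Aut_pow_apply[OF f pt_in_quadric[OF that], of n] Aut_one_apply[OF pt_in_quadric[OF that]] by simp
  then have "proportional (((*v) A ^^ n) s) s" if "s \<noteq> 0" for s
    using iter[OF that that, of n] pt_eq_iff[of "((*v) A ^^ n) s" "((*v) (cnjm A) ^^ n) s" s s] that by simp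
  then have pow: "\<forall>s. s \<noteq> 0 \<longrightarrow> proportional (((*v) A ^^ n) s) s" by blast
  show ?thesis
  proof (rule scalar_or_diagonalizable[OF n det pow])
    fix k assume scalar: "A = mat k"
    have "f = \<one>\<^bsub>Aut_quadric\<^esub>"
    proof (rule Aut_eqI[OF f one_closed])
      fix s t :: "complex^2" assume st: "s \<noteq> 0" "t \<noteq> 0"
      have "cnjm A = mat (cnj k)" unfolding scalar by (simp add: vec_eq_iff forall_2)
      then have "pt (A *v s) (cnjm A *v t) = pt s t"
        using pt_eq_iff[OF nz(1)[OF st(1)] nz(2)[OF st(2)] st] by (simp add: scalar mat_mult_vec proportional_def)
      then show "f (pt s t) = \<one>\<^bsub>Aut_quadric\<^esub> (pt s t)"
        using st by (simp add: fA Aut_one_apply pt_in_quadric)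
    qed
    then have "group.ord Aut_quadric f = 1" using ord_id by simp
    then show ?thesis using ord by simp
  next
    fix C :: "complex^2^2" and l m
    assume diagonal: "det C \<noteq> 0" "m \<noteq> 0" "l ^ n = m ^ n"
      "\<And>s. C *v (A *v s) = vector [l * (C *v s) $ 1, m * (C *v s) $ 2]"
    define u where "u = l / m"
    have l: "l = m * u" using diagonal(2) by (simp add: u_def)
    have "u ^ n = 1" using diagonal(2,3) by (simp add: u_def power_divide)
    then have "norm u ^ n = 1 ^ n" by (simp flip: norm_power)
    then have "norm u = 1" by (rule power_eq_imp_eq_base) (use n in auto)
    then have u: "u = cis (Arg2pi u)" using Arg2pi_eq[of u] by (simp add: cis_conv_exp)
    have "conjugate_in Aut_quadric f (rotation (Arg2pi u))"
    proof (rule conjugateI[OF f rotation_in_Aut_quadric diagonal(1)])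
      fix s t :: "complex^2" assume st: "s \<noteq> 0" "t \<noteq> 0"
      have C: "C *v v \<noteq> 0" "cnjm C *v v \<noteq> 0" if "v \<noteq> 0" for v
        using that diagonal(1) by (simp_all add: mult_vec_nonzero det_cnjm)
      let ?s = "vector [u * (C *v s) $ 1, (C *v s) $ 2] :: complex^2"
      let ?t = "vector [cnj u * (cnjm C *v t) $ 1, (cnjm C *v t) $ 2] :: complex^2"
      have s: "C *v (A *v s) = m *s ?s"
        by (simp add: diagonal(4) l vec_eq_iff forall_2)
      have "cnjm C *v (cnjm A *v t) = cnjv (C *v (A *v cnjv t))" by (simp add: cnjv_mult_vec)
      also have "\<dots> = cnj m *s ?t"
        unfolding diagonal(4) l by (simp add: vec_eq_iff forall_2 mult_vec_2)
      finally have t: "cnjm C *v (cnjm A *v t) = cnj m *s ?t" .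
      have nz': "C *v (A *v s) \<noteq> 0" "cnjm C *v (cnjm A *v t) \<noteq> 0"
        by (rule C(1)[OF nz(1)[OF st(1)]], rule C(2)[OF nz(2)[OF st(2)]])
      have "?s \<noteq> 0" "?t \<noteq> 0"
        using nz' unfolding s t by auto
      then have "pt (C *v (A *v s)) (cnjm C *v (cnjm A *v t)) = pt ?s ?t"
        using nz' unfolding s t by (subst pt_eq_iff) (auto simp: proportional_def)
      also have "\<dots> = rotation (Arg2pi u) (pt (C *v s) (cnjm C *v t))"
        using C[OF st(1)] C[OF st(2)] by (simp add: rotation_pt flip: u)
      finally show "induced (hermitian_act C) (f (pt s t)) = rotation (Arg2pi u) (pt (C *v s) (cnjm C *v t))"
        using st nz by (simp add: fA induced_hermitian_act_pt)
    qed
    then show ?thesis using Arg2pi_ge_0[of u] Arg2pi_lt_2pi[of u] by auto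
  qed
qed

text \<open>
  Odd powers exchange the two rulings and so are not the identity; the order is even, hence two.
\<close>

lemma prime_order_swapping_imp_involution:
  assumes f: "f \<in> carrier Aut_quadric" and ord: "prime (group.ord Aut_quadric f)"
    and det: "det B \<noteq> 0"
    and swaps: "swaps_by f B"
  shows "\<forall>p\<in>quadric. f (f p) = p"
proof -
  have fB: "f (pt s t) = pt (B *v t) (cnjm B *v s)" if "s \<noteq> 0" "t \<noteq> 0" for s t
    using swaps that by (simp add: swaps_by_def)
  interpret group Aut_quadric by (rule group_Aut_quadric)
  define n where "n = group.ord Aut_quadric f"
  have nz: "B *v s \<noteq> 0" "cnjm B *v s \<noteq> 0" if "s \<noteq> 0" for s
    using that det by (simp_all add: mult_vec_nonzero det_cnjm)
  have iter: "\<exists>X Y. (\<forall>s. s \<noteq> 0 \<longrightarrow> X s \<noteq> 0 \<and> Y s \<noteq> 0) \<and> (\<forall>s t. s \<noteq> 0 \<longrightarrow> t \<noteq> 0 \<longrightarrow>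
      (f ^^ j) (pt s t) = (if even j then pt (X s) (Y t) else pt (X t) (Y s)))" for j
  proof (induction j)
    case 0
    show ?case by (intro exI[of _ "\<lambda>s. s"]) auto
  next
    case (Suc j)
    then obtain X Y where XY: "\<forall>s. s \<noteq> 0 \<longrightarrow> X s \<noteq> 0 \<and> Y s \<noteq> 0" "\<forall>s t. s \<noteq> 0 \<longrightarrow> t \<noteq> 0 \<longrightarrow>
      (f ^^ j) (pt s t) = (if even j then pt (X s) (Y t) else pt (X t) (Y s))"
      by (elim exE conjE)
    show ?case
      by (rule exI[of _ "\<lambda>s. B *v Y s"], rule exI[of _ "\<lambda>s. cnjm B *v X s"]) (use XY in \<open>auto simp: fB nz\<close>)
  qed
  have "f [^]\<^bsub>Aut_quadric\<^esub> n = \<one>\<^bsub>Aut_quadric\<^esub>"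
    unfolding n_def by (rule pow_ord_eq_1[OF f])
  then have pow: "(f ^^ n) (pt s t) = pt s t" if "s \<noteq> 0" "t \<noteq> 0" for s t
    using Aut_pow_apply[OF f pt_in_quadric[OF that], of n] Aut_one_apply[OF pt_in_quadric[OF that]] by simp
  have "even n"
  proof (rule ccontr)
    assume odd: "odd n"
    obtain X Y where X: "\<forall>s. s \<noteq> 0 \<longrightarrow> X s \<noteq> 0 \<and> Y s \<noteq> 0" and XY: "\<forall>s t. s \<noteq> 0 \<longrightarrow> t \<noteq> 0 \<longrightarrow>
      (f ^^ n) (pt s t) = (if even n then pt (X s) (Y t) else pt (X t) (Y s))"
      using iter[of n] by (elim exE conjE)
    define e :: "complex^2" where "e = vector [1, 0]"
    have e: "e \<noteq> 0" by (simp add: e_def vec2_eq_0)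
    have proportional: "proportional (X e) s" if s: "s \<noteq> 0" for s
    proof -
      have "pt (X e) (Y s) = pt s e" using pow[OF s e] XY s e odd by simp
      then show ?thesis using pt_eq_iff[of "X e" "Y s" s e] X s e by simp
    qed
    have "X e $ 1 = 0 \<and> X e $ 2 = 0"
      using proportional[of "vector [1, 0]"] proportional[of "vector [0, 1]"] by (simp add: proportional_def vec2_eq_0)
    then have "X e = 0" by (simp add: vec2_eq_0)
    then show False using X e by blast
  qed
  then have "n = 2" using ord primes_dvd_imp_eq[OF two_is_prime_nat, of n] unfolding n_def by simp
  then have "f (f (pt s t)) = pt s t" if "s \<noteq> 0" "t \<noteq> 0" for s t
    using pow[OF that] by (simp add: numeral_2_eq_2)
  then show ?thesis by (auto elim: quadric_cases)
qed

text \<open>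
  The square of \<open>f\<close> acts by \<open>B (cnj B)\<close>, which is therefore a scalar \<open>k\<close>.  It is real because
  the trace of \<open>B (cnj B)\<close> is, and replacing \<open>B\<close> by a real multiple, which does not change \<open>f\<close>,
  reduces \<open>k\<close> to its sign.
\<close>

lemma involution_swapping_normal_form:
  assumes det: "det B \<noteq> 0"
    and swaps: "swaps_by f B"
    and inv: "\<forall>p\<in>quadric. f (f p) = p"
  shows "\<exists>B' e. det B' \<noteq> 0 \<and> (e = 1 \<or> e = - 1) \<and> B' ** cnjm B' = mat e \<and> swaps_by f B'"
proof -
  have fB: "f (pt s t) = pt (B *v t) (cnjm B *v s)" if "s \<noteq> 0" "t \<noteq> 0" for s t
    using swaps that by (simp add: swaps_by_def)
  have nz: "B *v s \<noteq> 0" "cnjm B *v s \<noteq> 0" if "s \<noteq> 0" for s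
    using that det by (simp_all add: mult_vec_nonzero det_cnjm)
  have "proportional ((B ** cnjm B) *v s) s" if s: "s \<noteq> 0" for s
  proof -
    have "pt (B *v (cnjm B *v s)) (cnjm B *v (B *v s)) = pt s s"
      using inv[rule_format, OF pt_in_quadric[OF s s]] fB[OF s s] fB[OF nz(1)[OF s] nz(2)[OF s]] by simp
    then show ?thesis
      using pt_eq_iff[OF nz(1)[OF nz(2)[OF s]] nz(2)[OF nz(1)[OF s]] s s]
      by (simp only: flip: matrix_vector_mul_assoc)
  qed
  then obtain k where k: "B ** cnjm B = mat k" by (rule scalar_if_all_proportional) blast
  have kk: "k * k = det B * cnj (det B)"
  proof -
    have "det (B ** cnjm B) = k * k" unfolding k by (simp add: det_2)
    then show ?thesis by (simp add: det_mul det_cnjm)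
  qed
  have "k + k = (B ** cnjm B) $ 1 $ 1 + (B ** cnjm B) $ 2 $ 2" unfolding k by simp
  also have "Im \<dots> = 0" by (simp add: mat_mult_2 algebra_simps)
  finally have k_real: "k = of_real (Re k)" by (simp add: complex_eq_iff)
  have "k \<noteq> 0" using kk det by auto
  then have Re_k: "Re k \<noteq> 0" using k_real by auto
  define r where "r = complex_of_real (sqrt \<bar>Re k\<bar>)"
  define e where "e = complex_of_real (sgn (Re k))"
  have r: "r \<noteq> 0" "cnj r = r" using Re_k by (simp_all add: r_def)
  have "r * r = of_real \<bar>Re k\<bar>"
    by (simp add: r_def flip: of_real_mult)
  then have rr: "k = e * (r * r)"
    by (subst k_real) (simp add: e_def sgn_if flip: of_real_mult)
  define B' :: "complex^2^2" where "B' = (\<chi> i j. B $ i $ j / r)"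
  have B': "B' *v s = (1 / r) *s (B *v s)" "cnjm B' *v s = (1 / r) *s (cnjm B *v s)" for s
    by (simp_all add: B'_def vec_eq_iff mult_vec_2 add_divide_distrib r)
  show ?thesis
  proof (rule exI[of _ B'], rule exI[of _ e], intro conjI allI impI)
    have "det B' = det B / (r * r)" using r by (simp add: B'_def det_2 field_simps)
    then show "det B' \<noteq> 0" using det r by simp
    show "e = 1 \<or> e = - 1" using Re_k by (auto simp: e_def sgn_if)
    have "(B' ** cnjm B') $ i $ j = (B ** cnjm B) $ i $ j / (r * r)" for i j
      using r by (simp add: B'_def mat_mult_2 add_divide_distrib)
    then show "B' ** cnjm B' = mat e"
      unfolding k using r by (simp add: vec_eq_iff forall_2 rr)
    have "pt (B *v t) (cnjm B *v s) = pt (B' *v t) (cnjm B' *v s)" if "s \<noteq> 0" "t \<noteq> 0" for s t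
      unfolding B' using nz[OF that(1)] nz[OF that(2)] r by (subst pt_eq_iff) (auto simp: proportional_def)
    then show "swaps_by f B'" using fB by (simp add: swaps_by_def)
  qed
qed

lemma swapping_conjugate:
  assumes f: "f \<in> carrier Aut_quadric" and g: "g \<in> carrier Aut_quadric"
    and det: "det B \<noteq> 0"
    and swaps: "swaps_by f B"
    and swaps0: "swaps_by g B\<^sub>0"
    and e: "e = 1 \<or> e = - 1" "B ** cnjm B = mat e" "B\<^sub>0 ** cnjm B\<^sub>0 = mat e"
  shows "conjugate_in Aut_quadric f g"
proof -
  have fB: "f (pt s t) = pt (B *v t) (cnjm B *v s)" if "s \<noteq> 0" "t \<noteq> 0" for s t
    using swaps that by (simp add: swaps_by_def)
  have gB: "g (pt s t) = pt (B\<^sub>0 *v t) (cnjm B\<^sub>0 *v s)" if "s \<noteq> 0" "t \<noteq> 0" for s t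
    using swaps0 that by (simp add: swaps_by_def)
  obtain A where A: "det A \<noteq> 0" "A ** B = B\<^sub>0 ** cnjm A" by (rule swapped_conjugator[OF e])
  have A': "cnjm A ** cnjm B = cnjm B\<^sub>0 ** A" using A(2) by (metis cnjm_mult cnjm_cnjm)
  have nz: "A *v s \<noteq> 0" "cnjm A *v s \<noteq> 0" "B *v s \<noteq> 0" "cnjm B *v s \<noteq> 0" if "s \<noteq> 0" for s
    using that det A(1) by (simp_all add: mult_vec_nonzero det_cnjm)
  show ?thesis
  proof (rule conjugateI[OF f g A(1)])
    fix s t :: "complex^2" assume st: "s \<noteq> 0" "t \<noteq> 0"
    show "induced (hermitian_act A) (f (pt s t)) = g (pt (A *v s) (cnjm A *v t))"
      using st nz by (simp add: fB gB induced_hermitian_act_pt matrix_vector_mul_assoc A(2) A')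
  qed
qed

text \<open>
  The sign \<open>e\<close> distinguishes the two classes of involutions that exchange the rulings: a reflection
  has real points as fixed points, the antipodal involution has none.
\<close>

theorem proposition4p3:
  assumes "g \<in> carrier Aut_quadric"
    and "Factorial_Ring.prime (group.ord Aut_quadric g)"
  shows "(\<exists>\<theta>\<in>{0..<2 * pi}. conjugate_in Aut_quadric g (rotation \<theta>)) \<or>
    conjugate_in Aut_quadric g reflection \<or>
    conjugate_in Aut_quadric g antipodal"
  using assms(1)
proof (cases rule: Aut_quadric_cases)
  case (preserving A)
  then show ?thesis using prime_order_preserving[OF assms] by blast
next
  case (swapping B)
  obtain B' e where B': "det B' \<noteq> 0" "e = 1 \<or> e = - 1" "B' ** cnjm B' = mat e" "swaps_by g B'"
    using involution_swapping_normal_form[OF swapping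
        prime_order_swapping_imp_involution[OF assms swapping]] by blast
  show ?thesis
  proof (cases "e = 1")
    case True
    define D :: "complex^2^2" where "D = vector [vector [1, 0], vector [0, -1]]"
    have "D ** cnjm D = mat e" by (simp add: True D_def vec_eq_iff forall_2 mat_mult_2)
    then have "conjugate_in Aut_quadric g reflection"
      using swapping_conjugate[OF assms(1) reflection_in_Aut_quadric B'(1,4)
          swaps_by_reflection[OF D_def] B'(2,3)] by blast
    then show ?thesis by blast
  next
    case False
    define J :: "complex^2^2" where "J = vector [vector [0, 1], vector [-1, 0]]"
    have "J ** cnjm J = mat e" using False B'(2) by (auto simp: J_def vec_eq_iff forall_2 mat_mult_2)
    then have "conjugate_in Aut_quadric g antipodal"
      using swapping_conjugate[OF assms(1) antipodal_in_Aut_quadric B'(1,4)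
          swaps_by_antipodal[OF J_def] B'(2,3)] by blast
    then show ?thesis by blast
  qed
qed

end
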